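(* Consider the algebra $$S=\mathbb Z\langle X_1,X_2,X_3\mid 1+X_3X_2X_1,\ 1+X_2X_1X_3,\ 1+X_1X_3X_2\rangle$$ of polynomials, with integral coefficients, in the non-commuting coefficient variables $X_1,X_2,X_3$, subject to the annihilation of the indicated polynomials (the quotient of the free unital associative ring on $X_1,X_2,X_3$ by the two-sided ideal generated by them; each $X_i$ is invertible in $S$). (a) The actions $$(1\ 2)\colon X_1\mapsto X_2^{-1},\ X_2\mapsto X_1^{-1},\ X_3\mapsto X_3^{-1}$$ and $$(2\ 3)\colon X_1\mapsto X_1^{-1},\ X_2\mapsto X_3^{-1},\ X_3\mapsto X_2^{-1}$$ generate a group $S_3$ of automorphisms of $S$. (b) Central piques are equivalent to right $S$-modules, with $$x\cdot y=xX_2+yX_1^{-1},\qquad x/y=xX_2^{-1}+yX_3,\qquad x\backslash y=xX_3^{-1}+yX_1,\qquad e=0$$ as the respective multiplication, right division, left division, and pointed idempotent; that is, these operations make each right $S$-module a central pique, and this assignment gives an equivalence between right $S$-modules (with module homomorphisms) and central piques (with pique homomorphisms). (c) The action of $S_3$ on $S$ from (a) induces a triality action on central piques as represented in (b): for $g,h\in S_3$, if the operation $\mu^h$ is represented by $xy\,\mu^h=xC+yD$ with $C,D\in S$, then $\mu^{hg}$ is represented by $xy\,\mu^{hg}=xC^g+yD^g$, where $C^g,D^g$ denote the images of $C,D$ under the automorphism $g$ of $S$.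
   Context: A quasigroup $(Q,\cdot,/,\backslash)$ is a set with three binary operations satisfying $x\cdot(x\backslash y)=y$, $y=(y/x)\cdot x$, $x\backslash(x\cdot y)=y$, $y=(y\cdot x)/x$. A pique is a quasigroup with a pointed idempotent element $e$ (a distinguished constant with $e\cdot e=e$); pique homomorphisms preserve the operations and $e$. An algebra $Q$ is central if the diagonal $\widehat Q=\{(x,x)\mid x\in Q\}$ is a normal subalgebra of $Q\times Q$, i.e. a congruence class of some congruence on $Q\times Q$. Triality: let $\sigma=(1\ 2)$ and $\tau=(2\ 3)$ in the symmetric group $S_3$, which is presented by $\sigma^2=\tau^2=(\sigma\tau)^3=1$. Binary operations are written postfix, $xy\,\mu=x\cdot y$. The six quasigroup operations form a regular right $S_3$-set $\{\mu^g\mid g\in S_3\}$ with $$xy\,\mu=x\cdot y,\quad xy\,\mu^{\sigma}=y\cdot x,\quad xy\,\mu^{\tau}=x\backslash y,\quad xy\,\mu^{\sigma\tau}=y\backslash x,\quad xy\,\mu^{\tau\sigma}=y/x,\quad xy\,\mu^{\sigma\tau\sigma}=x/y.$$ Group actions are right actions, so the element $gh$ acts as $g$ first, then $h$. *)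

theory Defs
  imports
    "HOL-Algebra.Algebra"
    "HOL-Algebra.Algebraic_Closure_Type"
    "HOL-Library.Poly_Mapping"
begin

section \<open>The free ring on a set of non-commuting variables\<close>

text \<open>Words are wrapped in a new type because the list type has no \<^class>\<open>monoid_add\<close> instance
  for concatenation; with that instance, finitely supported functions from words to the integers
  carry the convolution product of \<^theory>\<open>HOL-Library.Poly_Mapping\<close>, which makes them the free
  unital associative ring.\<close>

datatype 'x free_monoid = Word (letters: "'x list")

instantiation free_monoid :: (type) monoid_add
begin

definition zero_free_monoid :: "'a free_monoid"
  where "0 = Word []"

definition plus_free_monoid :: "'a free_monoid \<Rightarrow> 'a free_monoid \<Rightarrow> 'a free_monoid"
  where "u + v = Word (letters u @ letters v)"

instance
  by standard (simp_all add: zero_free_monoid_def plus_free_monoid_def)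

end

type_synonym 'x ncpoly = "'x free_monoid \<Rightarrow>\<^sub>0 int"

definition ncvar :: "'x \<Rightarrow> 'x ncpoly"
  where "ncvar i = Poly_Mapping.single (Word [i]) 1"

definition free_ring :: "'x ncpoly ring"
  where "free_ring = ring_of_type_algebra"


section \<open>The ring \<open>S\<close>\<close>

datatype gen = V1 | V2 | V3

type_synonym selt = "gen ncpoly set"

definition rel_ideal :: "gen ncpoly set"
  where "rel_ideal = Idl\<^bsub>free_ring\<^esub>
    {1 + ncvar V3 * ncvar V2 * ncvar V1,
     1 + ncvar V2 * ncvar V1 * ncvar V3,
     1 + ncvar V1 * ncvar V3 * ncvar V2}"

definition SR :: "selt ring"
  where "SR = free_ring Quot rel_ideal"

definition coef :: "gen \<Rightarrow> selt"
  where "coef i = rel_ideal +>\<^bsub>free_ring\<^esub> ncvar i"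

abbreviation "X1 \<equiv> coef V1"
abbreviation "X2 \<equiv> coef V2"
abbreviation "X3 \<equiv> coef V3"


section \<open>The symmetric group and ring automorphisms, acting on the right\<close>

text \<open>In both groups the product \<open>g h\<close> means: first \<open>g\<close>, then \<open>h\<close>.\<close>

definition S3 :: "(nat \<Rightarrow> nat) monoid"
  where "S3 = \<lparr>carrier = {p. p permutes {1..3}}, monoid.mult = (\<lambda>g h. h \<circ> g), one = id\<rparr>"

definition sigma :: "nat \<Rightarrow> nat" where "sigma = transpose 1 2"
definition tau :: "nat \<Rightarrow> nat" where "tau = transpose 2 3"

text \<open>As in \<^const>\<open>BijGroup\<close>, only extensional functions are admitted, so that distinct elements are
  distinct maps on the carrier.\<close>

definition ring_aut_group :: "('r, 'm) ring_scheme \<Rightarrow> ('r \<Rightarrow> 'r) monoid"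
  where "ring_aut_group R =
    \<lparr>carrier = ring_iso R R \<inter> extensional (carrier R),
     monoid.mult = (\<lambda>f g. compose (carrier R) g f),
     one = (\<lambda>x\<in>carrier R. x)\<rparr>"

definition generated_S3_action :: "((nat \<Rightarrow> nat) \<Rightarrow> selt \<Rightarrow> selt) \<Rightarrow> bool"
  where "generated_S3_action \<alpha> \<longleftrightarrow>
    \<alpha> \<in> extensional (carrier S3) \<and>
    \<alpha> sigma \<in> carrier (ring_aut_group SR) \<and>
    \<alpha> sigma X1 = inv\<^bsub>SR\<^esub> X2 \<and> \<alpha> sigma X2 = inv\<^bsub>SR\<^esub> X1 \<and> \<alpha> sigma X3 = inv\<^bsub>SR\<^esub> X3 \<and>
    \<alpha> tau \<in> carrier (ring_aut_group SR) \<and>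
    \<alpha> tau X1 = inv\<^bsub>SR\<^esub> X1 \<and> \<alpha> tau X2 = inv\<^bsub>SR\<^esub> X3 \<and> \<alpha> tau X3 = inv\<^bsub>SR\<^esub> X2 \<and>
    \<alpha> \<in> iso S3 (subgroup_generated (ring_aut_group SR) {\<alpha> sigma, \<alpha> tau})"


section \<open>Right modules\<close>

text \<open>As for \<^typ>\<open>('a, 'b) module\<close>, the multiplication and unit fields inherited from the ring
  record play no role.\<close>

record ('r, 'a) rmodule = "'a ring" +
  ract :: "'a \<Rightarrow> 'r \<Rightarrow> 'a" (infixl \<open>\<star>\<index>\<close> 70)

locale right_module = R?: ring R + M?: abelian_group M
  for R :: "('r, 'k) ring_scheme" (structure) and M :: "('r, 'a, 'm) rmodule_scheme" (structure) +
  assumes ract_closed: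
      "\<lbrakk>x \<in> carrier M; a \<in> carrier R\<rbrakk> \<Longrightarrow> x \<star>\<^bsub>M\<^esub> a \<in> carrier M"
    and ract_add_scalar:
      "\<lbrakk>x \<in> carrier M; a \<in> carrier R; b \<in> carrier R\<rbrakk>
        \<Longrightarrow> x \<star>\<^bsub>M\<^esub> (a \<oplus>\<^bsub>R\<^esub> b) = x \<star>\<^bsub>M\<^esub> a \<oplus>\<^bsub>M\<^esub> x \<star>\<^bsub>M\<^esub> b"
    and ract_add_vector:
      "\<lbrakk>x \<in> carrier M; y \<in> carrier M; a \<in> carrier R\<rbrakk>
        \<Longrightarrow> (x \<oplus>\<^bsub>M\<^esub> y) \<star>\<^bsub>M\<^esub> a = x \<star>\<^bsub>M\<^esub> a \<oplus>\<^bsub>M\<^esub> y \<star>\<^bsub>M\<^esub> a"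
    and ract_mult:
      "\<lbrakk>x \<in> carrier M; a \<in> carrier R; b \<in> carrier R\<rbrakk>
        \<Longrightarrow> x \<star>\<^bsub>M\<^esub> (a \<otimes>\<^bsub>R\<^esub> b) = (x \<star>\<^bsub>M\<^esub> a) \<star>\<^bsub>M\<^esub> b"
    and ract_one:
      "x \<in> carrier M \<Longrightarrow> x \<star>\<^bsub>M\<^esub> \<one>\<^bsub>R\<^esub> = x"

definition rmodule_hom ::
    "('r, 'k) ring_scheme \<Rightarrow> ('r, 'a) rmodule \<Rightarrow> ('r, 'b) rmodule \<Rightarrow> ('a \<Rightarrow> 'b) set"
  where "rmodule_hom R M N = {f \<in> carrier M \<rightarrow>\<^sub>E carrier N.
    (\<forall>x\<in>carrier M. \<forall>y\<in>carrier M. f (x \<oplus>\<^bsub>M\<^esub> y) = f x \<oplus>\<^bsub>N\<^esub> f y) \<and>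
    (\<forall>x\<in>carrier M. \<forall>a\<in>carrier R. f (x \<star>\<^bsub>M\<^esub> a) = f x \<star>\<^bsub>N\<^esub> a)}"


section \<open>Quasigroups, piques and centrality\<close>

text \<open>\<open>rdiv Q x y\<close> is $x/y$ and \<open>ldiv Q x y\<close> is $x \backslash y$.\<close>

record 'a quasigroup = "'a partial_object" +
  qmult :: "'a \<Rightarrow> 'a \<Rightarrow> 'a"
  rdiv :: "'a \<Rightarrow> 'a \<Rightarrow> 'a"
  ldiv :: "'a \<Rightarrow> 'a \<Rightarrow> 'a"

record 'a pique = "'a quasigroup" +
  point :: 'a

locale quasigroup =
  fixes Q :: "('a, 'm) quasigroup_scheme" (structure)
  assumes qmult_closed: "\<lbrakk>x \<in> carrier Q; y \<in> carrier Q\<rbrakk> \<Longrightarrow> qmult Q x y \<in> carrier Q"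
    and rdiv_closed: "\<lbrakk>x \<in> carrier Q; y \<in> carrier Q\<rbrakk> \<Longrightarrow> rdiv Q x y \<in> carrier Q"
    and ldiv_closed: "\<lbrakk>x \<in> carrier Q; y \<in> carrier Q\<rbrakk> \<Longrightarrow> ldiv Q x y \<in> carrier Q"
    and qmult_ldiv: "\<lbrakk>x \<in> carrier Q; y \<in> carrier Q\<rbrakk> \<Longrightarrow> qmult Q x (ldiv Q x y) = y"
    and qmult_rdiv: "\<lbrakk>x \<in> carrier Q; y \<in> carrier Q\<rbrakk> \<Longrightarrow> y = qmult Q (rdiv Q y x) x"
    and ldiv_qmult: "\<lbrakk>x \<in> carrier Q; y \<in> carrier Q\<rbrakk> \<Longrightarrow> ldiv Q x (qmult Q x y) = y"
    and rdiv_qmult: "\<lbrakk>x \<in> carrier Q; y \<in> carrier Q\<rbrakk> \<Longrightarrow> y = rdiv Q (qmult Q y x) x"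

locale pique = quasigroup Q for Q :: "('a, 'm) pique_scheme" (structure) +
  assumes point_closed: "point Q \<in> carrier Q"
    and point_idem: "qmult Q (point Q) (point Q) = point Q"

definition pique_hom :: "'a pique \<Rightarrow> 'b pique \<Rightarrow> ('a \<Rightarrow> 'b) set"
  where "pique_hom P Q = {f \<in> carrier P \<rightarrow>\<^sub>E carrier Q.
    (\<forall>x\<in>carrier P. \<forall>y\<in>carrier P.
      f (qmult P x y) = qmult Q (f x) (f y) \<and>
      f (rdiv P x y) = rdiv Q (f x) (f y) \<and>
      f (ldiv P x y) = ldiv Q (f x) (f y)) \<and>
    f (point P) = point Q}"

definition pique_prod :: "'a pique \<Rightarrow> 'b pique \<Rightarrow> ('a \<times> 'b) pique"
  where "pique_prod P Q =
    \<lparr>carrier = carrier P \<times> carrier Q,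
     qmult = (\<lambda>(x, y) (x', y'). (qmult P x x', qmult Q y y')),
     rdiv = (\<lambda>(x, y) (x', y'). (rdiv P x x', rdiv Q y y')),
     ldiv = (\<lambda>(x, y) (x', y'). (ldiv P x x', ldiv Q y y')),
     point = (point P, point Q)\<rparr>"

definition subpique :: "'a set \<Rightarrow> 'a pique \<Rightarrow> bool"
  where "subpique H Q \<longleftrightarrow> H \<subseteq> carrier Q \<and> point Q \<in> H \<and>
    (\<forall>x\<in>H. \<forall>y\<in>H. qmult Q x y \<in> H \<and> rdiv Q x y \<in> H \<and> ldiv Q x y \<in> H)"

text \<open>The constant \<^const>\<open>point\<close> imposes no condition on a congruence.\<close>

definition pique_congruence :: "'a pique \<Rightarrow> ('a \<times> 'a) set \<Rightarrow> bool"
  where "pique_congruence Q \<theta> \<longleftrightarrow> equiv (carrier Q) \<theta> \<and>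
    (\<forall>(x, x')\<in>\<theta>. \<forall>(y, y')\<in>\<theta>.
      (qmult Q x y, qmult Q x' y') \<in> \<theta> \<and>
      (rdiv Q x y, rdiv Q x' y') \<in> \<theta> \<and>
      (ldiv Q x y, ldiv Q x' y') \<in> \<theta>)"

definition normal_subpique :: "'a set \<Rightarrow> 'a pique \<Rightarrow> bool"
  where "normal_subpique H Q \<longleftrightarrow> subpique H Q \<and>
    (\<exists>\<theta>. pique_congruence Q \<theta> \<and> H \<in> carrier Q // \<theta>)"

definition central_pique :: "'a pique \<Rightarrow> bool"
  where "central_pique Q \<longleftrightarrow> pique Q \<and>
    normal_subpique {(x, x) | x. x \<in> carrier Q} (pique_prod Q Q)"

text \<open>The six conjugate operations: \<open>conj_op g Q x y\<close> is \<open>xy \<mu>\<^sup>g\<close>. Products of permutations are taken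
  in \<^const>\<open>S3\<close>, so \<open>sigma tau\<close> is first \<open>sigma\<close>, then \<open>tau\<close>; the last case is that of
  \<open>sigma tau sigma\<close>.\<close>

definition conj_op :: "(nat \<Rightarrow> nat) \<Rightarrow> 'a pique \<Rightarrow> 'a \<Rightarrow> 'a \<Rightarrow> 'a"
  where "conj_op g Q x y =
    (if g = \<one>\<^bsub>S3\<^esub> then qmult Q x y
     else if g = sigma then qmult Q y x
     else if g = tau then ldiv Q x y
     else if g = sigma \<otimes>\<^bsub>S3\<^esub> tau then ldiv Q y x
     else if g = tau \<otimes>\<^bsub>S3\<^esub> sigma then rdiv Q y x
     else rdiv Q x y)"


section \<open>Categories and equivalences\<close>

text \<open>Hom-sets need not be disjoint, so composition and the action of a functor on morphisms take
  the objects involved as arguments: \<open>Comp C A B D g f\<close> is \<open>g\<close> after \<open>f\<close> for \<open>f : A \<rightarrow> B\<close> and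
  \<open>g : B \<rightarrow> D\<close>.\<close>

record ('o, 'm) cat =
  Obj :: "'o set"
  Hom :: "'o \<Rightarrow> 'o \<Rightarrow> 'm set"
  Ident :: "'o \<Rightarrow> 'm"
  Comp :: "'o \<Rightarrow> 'o \<Rightarrow> 'o \<Rightarrow> 'm \<Rightarrow> 'm \<Rightarrow> 'm"

locale cat_category =
  fixes C :: "('o, 'm) cat"
  assumes ident_in: "A \<in> Obj C \<Longrightarrow> Ident C A \<in> Hom C A A"
    and comp_in: "\<lbrakk>A \<in> Obj C; B \<in> Obj C; D \<in> Obj C; f \<in> Hom C A B; g \<in> Hom C B D\<rbrakk>
      \<Longrightarrow> Comp C A B D g f \<in> Hom C A D"
    and ident_right: "\<lbrakk>A \<in> Obj C; B \<in> Obj C; f \<in> Hom C A B\<rbrakk>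
      \<Longrightarrow> Comp C A A B f (Ident C A) = f"
    and ident_left: "\<lbrakk>A \<in> Obj C; B \<in> Obj C; f \<in> Hom C A B\<rbrakk>
      \<Longrightarrow> Comp C A B B (Ident C B) f = f"
    and comp_assoc: "\<lbrakk>A \<in> Obj C; B \<in> Obj C; D \<in> Obj C; E \<in> Obj C;
        f \<in> Hom C A B; g \<in> Hom C B D; h \<in> Hom C D E\<rbrakk>
      \<Longrightarrow> Comp C A D E h (Comp C A B D g f) = Comp C A B E (Comp C B D E h g) f"

locale cat_functor = C: cat_category C + D: cat_category D
  for C :: "('o, 'm) cat" and D :: "('p, 'n) cat" +
  fixes Fo :: "'o \<Rightarrow> 'p" and Fm :: "'o \<Rightarrow> 'o \<Rightarrow> 'm \<Rightarrow> 'n"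
  assumes obj_in: "A \<in> Obj C \<Longrightarrow> Fo A \<in> Obj D"
    and hom_in: "\<lbrakk>A \<in> Obj C; B \<in> Obj C; f \<in> Hom C A B\<rbrakk> \<Longrightarrow> Fm A B f \<in> Hom D (Fo A) (Fo B)"
    and map_ident: "A \<in> Obj C \<Longrightarrow> Fm A A (Ident C A) = Ident D (Fo A)"
    and map_comp: "\<lbrakk>A \<in> Obj C; B \<in> Obj C; E \<in> Obj C; f \<in> Hom C A B; g \<in> Hom C B E\<rbrakk>
      \<Longrightarrow> Fm A E (Comp C A B E g f) = Comp D (Fo A) (Fo B) (Fo E) (Fm B E g) (Fm A B f)"

definition cat_iso :: "('o, 'm) cat \<Rightarrow> 'o \<Rightarrow> 'o \<Rightarrow> 'm \<Rightarrow> bool"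
  where "cat_iso C A B f \<longleftrightarrow> f \<in> Hom C A B \<and>
    (\<exists>g\<in>Hom C B A. Comp C A B A g f = Ident C A \<and> Comp C B A B f g = Ident C B)"

definition cat_nat_iso ::
    "('o, 'm) cat \<Rightarrow> ('p, 'n) cat \<Rightarrow> ('o \<Rightarrow> 'p) \<Rightarrow> ('o \<Rightarrow> 'o \<Rightarrow> 'm \<Rightarrow> 'n) \<Rightarrow>
      ('o \<Rightarrow> 'p) \<Rightarrow> ('o \<Rightarrow> 'o \<Rightarrow> 'm \<Rightarrow> 'n) \<Rightarrow> ('o \<Rightarrow> 'n) \<Rightarrow> bool"
  where "cat_nat_iso C D Fo Fm Go Gm \<eta> \<longleftrightarrow>
    (\<forall>A\<in>Obj C. cat_iso D (Fo A) (Go A) (\<eta> A)) \<and>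
    (\<forall>A\<in>Obj C. \<forall>B\<in>Obj C. \<forall>f\<in>Hom C A B.
      Comp D (Fo A) (Fo B) (Go B) (\<eta> B) (Fm A B f) =
      Comp D (Fo A) (Go A) (Go B) (Gm A B f) (\<eta> A))"

definition cat_equivalence ::
    "('o, 'm) cat \<Rightarrow> ('p, 'n) cat \<Rightarrow> ('o \<Rightarrow> 'p) \<Rightarrow> ('o \<Rightarrow> 'o \<Rightarrow> 'm \<Rightarrow> 'n) \<Rightarrow> bool"
  where "cat_equivalence C D Fo Fm \<longleftrightarrow> cat_functor C D Fo Fm \<and>
    (\<exists>Go Gm \<eta> \<epsilon>. cat_functor D C Go Gm \<and>
      cat_nat_iso C C (\<lambda>A. A) (\<lambda>A B f. f)
        (\<lambda>A. Go (Fo A)) (\<lambda>A B f. Gm (Fo A) (Fo B) (Fm A B f)) \<eta> \<and>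
      cat_nat_iso D D (\<lambda>A. Fo (Go A)) (\<lambda>A B f. Fm (Go A) (Go B) (Gm A B f))
        (\<lambda>A. A) (\<lambda>A B f. f) \<epsilon>)"

text \<open>The type \<open>'a\<close> plays the role of the universe from which carriers are taken.\<close>

definition rmodule_cat :: "('r, 'k) ring_scheme \<Rightarrow> (('r, 'a) rmodule, 'a \<Rightarrow> 'a) cat"
  where "rmodule_cat R =
    \<lparr>Obj = {M. right_module R M},
     Hom = rmodule_hom R,
     Ident = (\<lambda>M. \<lambda>x\<in>carrier M. x),
     Comp = (\<lambda>M N P g f. compose (carrier M) g f)\<rparr>"

definition central_pique_cat :: "('a pique, 'a \<Rightarrow> 'a) cat"
  where "central_pique_cat =
    \<lparr>Obj = {Q. central_pique Q},
     Hom = pique_hom,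
     Ident = (\<lambda>Q. \<lambda>x\<in>carrier Q. x),
     Comp = (\<lambda>P Q R g f. compose (carrier P) g f)\<rparr>"


section \<open>Piques from right \<open>S\<close>-modules\<close>

definition pique_of_module :: "(selt, 'a) rmodule \<Rightarrow> 'a pique"
  where "pique_of_module M =
    \<lparr>carrier = carrier M,
     qmult = (\<lambda>x y. x \<star>\<^bsub>M\<^esub> X2 \<oplus>\<^bsub>M\<^esub> y \<star>\<^bsub>M\<^esub> inv\<^bsub>SR\<^esub> X1),
     rdiv = (\<lambda>x y. x \<star>\<^bsub>M\<^esub> inv\<^bsub>SR\<^esub> X2 \<oplus>\<^bsub>M\<^esub> y \<star>\<^bsub>M\<^esub> X3),
     ldiv = (\<lambda>x y. x \<star>\<^bsub>M\<^esub> inv\<^bsub>SR\<^esub> X3 \<oplus>\<^bsub>M\<^esub> y \<star>\<^bsub>M\<^esub> X1),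
     point = \<zero>\<^bsub>M\<^esub>\<rparr>"

text \<open>The operation \<open>\<mu>\<^sup>h\<close> is represented by \<open>xC + yD\<close>, as a formula valid in all right \<open>S\<close>-modules
  with carrier in \<open>'a\<close>. In a single module the coefficients are in general not determined by the
  operation; with \<open>'a\<close> taken to be \<^typ>\<open>selt\<close>, the regular module \<open>S\<close> is included and they are.\<close>

definition represented_by :: "'a itself \<Rightarrow> (nat \<Rightarrow> nat) \<Rightarrow> selt \<Rightarrow> selt \<Rightarrow> bool"
  where "represented_by T h C D \<longleftrightarrow>
    (\<forall>M :: (selt, 'a) rmodule. right_module SR M \<longrightarrow>
      (\<forall>x\<in>carrier M. \<forall>y\<in>carrier M.
        conj_op h (pique_of_module M) x y = x \<star>\<^bsub>M\<^esub> C \<oplus>\<^bsub>M\<^esub> y \<star>\<^bsub>M\<^esub> D))"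

end

theory Submission
  imports Defs
begin

text \<open>The relations make every \<open>X\<^sub>i\<close> invertible, and a permutation \<open>g\<close> acts on \<open>S\<close> by sending \<open>X\<^sub>i\<close> to
  \<open>X\<^bsub>g(i)\<^esub>\<close> or to its inverse, according to the sign of \<open>g\<close>; this respects the relations, and it is
  faithful because an evaluation of \<open>S\<close> in the rationals separates the images of \<open>X\<^sub>1\<close>.

  If the diagonal is a class of a congruence on \<open>Q \<times> Q\<close>, then that congruence is the graph of the
  Mal'cev operation of \<open>Q\<close>, which therefore commutes with all operations. By an Eckmann--Hilton
  argument \<open>x + y = (x/e)\<cdot>(e\y)\<close> makes \<open>Q\<close> an abelian group on which all operations are linear, and the
  maps \<open>e\x\<close>, \<open>x\<cdot>e\<close>, \<open>e/x\<close> satisfy the relations of \<open>X\<^sub>1\<close>, \<open>X\<^sub>2\<close>, \<open>X\<^sub>3\<close>. A map between modules is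
  linear iff it is a pique homomorphism, so that the equivalence is the identity on hom-sets.\<close>

section \<open>The universal property of the ring\<close>

lemma poly_mapping_sum_induct [case_names single add]:
  assumes single: "\<And>k v. P (Poly_Mapping.single k v)"
    and add: "\<And>p q. P p \<Longrightarrow> P q \<Longrightarrow> P (p + q)"
  shows "P (p :: 'k \<Rightarrow>\<^sub>0 'v :: monoid_add)"
proof (induction p rule: update_induct)
  case const
  show ?case
    \<comment> \<open>The zero function is the single with value 0, at whatever key.\<close>
    using single[of undefined 0] by simp
next
  case (update f a b)
  have "Poly_Mapping.update a b f = f + Poly_Mapping.single a b"
    using update.hyps by (intro poly_mapping_eqI)
      (auto simp: lookup_update lookup_add lookup_single in_keys_iff when_def)
  with add update.IH single show ?case by metis
qed

text \<open>A word is a product of variables; its nonnegative multiples arise by repeated addition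
  and the negative ones from \<open>uminus\<close>. So the variables generate the free ring as a
  unital ring.\<close>

lemma ncpoly_induct [case_names one var add uminus mult]:
  assumes one: "P 1" and var: "\<And>i. P (ncvar i)"
    and add: "\<And>p q. P p \<Longrightarrow> P q \<Longrightarrow> P (p + q)"
    and uminus: "\<And>p. P p \<Longrightarrow> P (- p)"
    and mult: "\<And>p q. P p \<Longrightarrow> P q \<Longrightarrow> P (p * q)"
  shows "P (p :: 'x ncpoly)"
proof (induction p rule: poly_mapping_sum_induct)
  case (single w v)
  have word: "P (Poly_Mapping.single (Word l) 1)" for l
  proof (induction l)
    case Nil
    with one show ?case
      by (metis single_one zero_free_monoid_def)
  next
    case (Cons i l)
    have "Poly_Mapping.single (Word (i # l)) (1 :: int) = ncvar i * Poly_Mapping.single (Word l) 1"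
      by (simp add: ncvar_def mult_single plus_free_monoid_def)
    with mult[OF var Cons.IH] show ?case by metis
  qed
  have zero: "P 0"
    using add[OF one uminus[OF one]] by simp
  have nat: "P (Poly_Mapping.single w (int n))" for n
  proof (induction n)
    case (Suc n)
    have "Poly_Mapping.single w (int (Suc n)) =
        Poly_Mapping.single w 1 + Poly_Mapping.single w (int n)"
      by (simp flip: single_add)
    with add[OF word[of "letters w"] Suc.IH] show ?case by simp
  qed (simp add: zero)
  show ?case
  proof (cases "v \<ge> 0")
    case True
    then show ?thesis using nat[of "nat v"] by simp
  next
    case False
    then have "Poly_Mapping.single w v = - Poly_Mapping.single w (int (nat (- v)))"
      by (simp flip: single_uminus)
    then show ?thesis using uminus[OF nat] by metis
  qed
qed (rule add)

lemma ring_of_ring_1: "ring (ring_of_type_algebra :: 'a :: ring_1 ring)"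
proof -
  have "\<exists>y. x + y = 0" for x :: 'a
    using add.right_inverse by blast
  then show ?thesis
    unfolding ring_of_type_algebra_def using add.right_inverse
    by unfold_locales (auto simp: algebra_simps Units_def)
qed

lemma ring_free_ring: "ring free_ring"
  unfolding free_ring_def by (rule ring_of_ring_1)

lemma free_ring_simps [simp]:
  "carrier free_ring = UNIV" "\<zero>\<^bsub>free_ring\<^esub> = 0" "\<one>\<^bsub>free_ring\<^esub> = 1"
  "p \<oplus>\<^bsub>free_ring\<^esub> q = p + q" "p \<otimes>\<^bsub>free_ring\<^esub> q = p * q"
  by (simp_all add: free_ring_def ring_of_type_algebra_def)

lemma free_ring_uminus [simp]: "\<ominus>\<^bsub>free_ring\<^esub> p = - p"
proof -
  interpret ring "free_ring :: 'a ncpoly ring" by (rule ring_free_ring)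
  show ?thesis by (rule minus_equality) auto
qed

section \<open>Evaluation of noncommutative polynomials in a ring\<close>

context ring
begin

definition word_eval :: "('x \<Rightarrow> 'a) \<Rightarrow> 'x free_monoid \<Rightarrow> 'a"
  where "word_eval f w = foldr (\<lambda>i a. f i \<otimes> a) (letters w) \<one>"

definition free_eval :: "('x \<Rightarrow> 'a) \<Rightarrow> 'x ncpoly \<Rightarrow> 'a"
  where "free_eval f p =
    (\<Oplus>w\<in>Poly_Mapping.keys p. [Poly_Mapping.lookup p w] \<cdot> word_eval f w)"

lemma word_eval_closed:
  assumes "\<And>i. f i \<in> carrier R"
  shows "word_eval f w \<in> carrier R"
proof -
  have "foldr (\<lambda>i a. f i \<otimes> a) l \<one> \<in> carrier R" for l
    using assms by (induction l) auto
  then show ?thesis by (simp add: word_eval_def)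
qed

lemma word_eval_add:
  assumes "\<And>i. f i \<in> carrier R"
  shows "word_eval f (v + w) = word_eval f v \<otimes> word_eval f w"
proof -
  have "foldr (\<lambda>i a. f i \<otimes> a) l (word_eval f w) = foldr (\<lambda>i a. f i \<otimes> a) l \<one> \<otimes> word_eval f w" for l
    using assms word_eval_closed[of f, OF assms] word_eval_closed[of f "Word _", OF assms]
    by (induction l) (auto simp: word_eval_def m_assoc)
  then show ?thesis by (simp add: word_eval_def plus_free_monoid_def)
qed

lemma free_eval_closed:
  assumes "\<And>i. f i \<in> carrier R"
  shows "free_eval f p \<in> carrier R"
  unfolding free_eval_def by (intro finsum_closed) (auto intro: word_eval_closed assms)

text \<open>Polynomials with different supports can be compared once they are summed over one common
  finite set of words.\<close>

lemma free_eval_superset: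
  assumes "\<And>i. f i \<in> carrier R" "finite A" "Poly_Mapping.keys p \<subseteq> A"
  shows "free_eval f p = (\<Oplus>w\<in>A. [Poly_Mapping.lookup p w] \<cdot> word_eval f w)"
  unfolding free_eval_def using assms(2,3)
  by (intro add.finprod_mono_neutral_cong_left)
    (auto simp: in_keys_iff add_pow_int_ge intro!: word_eval_closed assms)

lemma free_eval_add:
  assumes f: "\<And>i. f i \<in> carrier R"
  shows "free_eval f (p + q) = free_eval f p \<oplus> free_eval f q"
proof -
  define A where "A = Poly_Mapping.keys p \<union> Poly_Mapping.keys q"
  have A: "finite A" "Poly_Mapping.keys p \<subseteq> A" "Poly_Mapping.keys q \<subseteq> A" "Poly_Mapping.keys (p + q) \<subseteq> A"
    using keys_add[of p q] by (auto simp: A_def)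
  show ?thesis
    unfolding free_eval_superset[OF f A(1,2)] free_eval_superset[OF f A(1,3)]
      free_eval_superset[OF f A(1,4)]
    by (subst finsum_addf[symmetric])
      (auto simp: lookup_add add.int_pow_mult word_eval_closed f intro!: finsum_cong')
qed

lemma free_eval_single:
  assumes f: "\<And>i. f i \<in> carrier R"
  shows "free_eval f (Poly_Mapping.single w a) = [a] \<cdot> word_eval f w"
  by (subst free_eval_superset[of _ "{w}"])
    (auto simp: finsum_insert word_eval_closed f keys_single)

text \<open>Both sides are additive in \<open>p\<close> and in \<open>q\<close>, so monomials
  suffice; there words concatenate and the integer multiples can be pulled out of the
  product.\<close>

lemma free_eval_mult:
  assumes f: "\<And>i. f i \<in> carrier R"
  shows "free_eval f (p * q) = free_eval f p \<otimes> free_eval f q"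
proof (induction p rule: poly_mapping_sum_induct)
  case (single v a)
  show ?case
  proof (induction q rule: poly_mapping_sum_induct)
    case (single w b)
    have "add_pow R (a * b) (word_eval f v \<otimes> word_eval f w) =
        add_pow R a (word_eval f v) \<otimes> add_pow R b (word_eval f w)"
      using word_eval_closed[of f, OF f]
      by (simp add: add_pow_ldistr_int add_pow_rdistr_int add.int_pow_pow mult.commute)
    then show ?case
      by (simp add: mult_single free_eval_single f word_eval_add)
  next
    case (add q r)
    then show ?case
      by (simp add: distrib_left free_eval_add f r_distr free_eval_closed)
  qed
next
  case (add p r)
  then show ?case
    by (simp add: distrib_right free_eval_add f l_distr free_eval_closed)
qed

lemma free_eval_ncvar:
  assumes f: "\<And>i. f i \<in> carrier R"
  shows "free_eval f (ncvar i) = f i"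
  by (simp add: ncvar_def free_eval_single f) (simp add: word_eval_def f)

lemma free_eval_hom:
  assumes f: "\<And>i. f i \<in> carrier R"
  shows "free_eval f \<in> ring_hom free_ring R"
proof (rule ring_hom_memI)
  have "free_eval f 1 = \<one>"
    by (simp add: free_eval_single f flip: single_one) (simp add: word_eval_def zero_free_monoid_def)
  then show "free_eval f \<one>\<^bsub>free_ring\<^esub> = \<one>" by simp
qed (simp_all add: f free_eval_add free_eval_mult free_eval_closed)

end

section \<open>The presentation of S and its universal property\<close>

lemma rel_ideal: "ideal rel_ideal free_ring"
  unfolding rel_ideal_def by (rule ring.genideal_ideal[OF ring_free_ring]) simp

lemma ring_SR: "ring SR"
  unfolding SR_def by (rule ideal.quotient_is_ring[OF rel_ideal])

interpretation SR: ring SR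
  by (rule ring_SR)

definition SR_proj :: "gen ncpoly \<Rightarrow> selt"
  where "SR_proj p = rel_ideal +>\<^bsub>free_ring\<^esub> p"

lemma SR_proj_simps:
  "SR_proj 1 = \<one>\<^bsub>SR\<^esub>" "SR_proj (p + q) = SR_proj p \<oplus>\<^bsub>SR\<^esub> SR_proj q"
  "SR_proj (- p) = \<ominus>\<^bsub>SR\<^esub> SR_proj p" "SR_proj (p * q) = SR_proj p \<otimes>\<^bsub>SR\<^esub> SR_proj q"
  "SR_proj p \<in> carrier SR"
proof -
  interpret ring_hom_ring free_ring SR SR_proj
    using ideal.rcos_ring_hom_ring[OF rel_ideal] by (simp add: SR_def SR_proj_def[abs_def])
  show "SR_proj 1 = \<one>\<^bsub>SR\<^esub>" "SR_proj (p + q) = SR_proj p \<oplus>\<^bsub>SR\<^esub> SR_proj q"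
    "SR_proj (- p) = \<ominus>\<^bsub>SR\<^esub> SR_proj p" "SR_proj (p * q) = SR_proj p \<otimes>\<^bsub>SR\<^esub> SR_proj q"
    "SR_proj p \<in> carrier SR"
    using hom_one hom_add[of p q] hom_a_inv[of p] hom_mult[of p q] hom_closed[of p]
    by simp_all
qed

lemma SR_proj_ncvar: "SR_proj (ncvar i) = coef i"
  by (simp add: SR_proj_def coef_def)

lemma coef_closed [simp, intro]: "coef i \<in> carrier SR"
  by (simp add: SR_proj_simps flip: SR_proj_ncvar)

lemma carrier_SR: "carrier SR = range SR_proj"
  by (auto simp: SR_def FactRing_def A_RCOSETS_def' SR_proj_def)

text \<open>\<open>SR_proj\<close> is surjective, so the generation of the free ring by its
  variables passes to the quotient.\<close>

lemma SR_induct [consumes 1, case_names one coef add uminus mult]: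
  assumes a: "a \<in> carrier SR"
    and one: "P \<one>\<^bsub>SR\<^esub>" and coef: "\<And>i. P (coef i)"
    and add: "\<And>a b. \<lbrakk>a \<in> carrier SR; b \<in> carrier SR; P a; P b\<rbrakk> \<Longrightarrow> P (a \<oplus>\<^bsub>SR\<^esub> b)"
    and uminus: "\<And>a. \<lbrakk>a \<in> carrier SR; P a\<rbrakk> \<Longrightarrow> P (\<ominus>\<^bsub>SR\<^esub> a)"
    and mult: "\<And>a b. \<lbrakk>a \<in> carrier SR; b \<in> carrier SR; P a; P b\<rbrakk> \<Longrightarrow> P (a \<otimes>\<^bsub>SR\<^esub> b)"
  shows "P a"
proof -
  have "P (SR_proj p)" for p
    by (induction p rule: ncpoly_induct)
      (simp_all add: SR_proj_simps SR_proj_ncvar one coef add uminus mult)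
  with a show ?thesis by (auto simp: carrier_SR)
qed

lemma SR_hom_eqI:
  assumes "ring R" "h \<in> ring_hom SR R" "k \<in> ring_hom SR R"
    and eq: "\<And>i. h (coef i) = k (coef i)" and a: "a \<in> carrier SR"
  shows "h a = k a"
proof -
  interpret h: ring_hom_ring SR R h
    using assms by (intro ring_hom_ringI2 ring_SR)
  interpret k: ring_hom_ring SR R k
    using assms by (intro ring_hom_ringI2 ring_SR)
  from a show ?thesis
    by (induction rule: SR_induct) (simp_all add: eq)
qed

lemma rel_ideal_memI:
  "1 + ncvar V3 * ncvar V2 * ncvar V1 \<in> rel_ideal"
  "1 + ncvar V2 * ncvar V1 * ncvar V3 \<in> rel_ideal"
  "1 + ncvar V1 * ncvar V3 * ncvar V2 \<in> rel_ideal"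
  using ring.genideal_self[OF ring_free_ring, of
    "{1 + ncvar V3 * ncvar V2 * ncvar V1, 1 + ncvar V2 * ncvar V1 * ncvar V3,
      1 + ncvar V1 * ncvar V3 * ncvar V2}"]
  unfolding rel_ideal_def by simp_all

lemma SR_relations:
  "\<one>\<^bsub>SR\<^esub> \<oplus>\<^bsub>SR\<^esub> X3 \<otimes>\<^bsub>SR\<^esub> X2 \<otimes>\<^bsub>SR\<^esub> X1 = \<zero>\<^bsub>SR\<^esub>"
  "\<one>\<^bsub>SR\<^esub> \<oplus>\<^bsub>SR\<^esub> X2 \<otimes>\<^bsub>SR\<^esub> X1 \<otimes>\<^bsub>SR\<^esub> X3 = \<zero>\<^bsub>SR\<^esub>"
  "\<one>\<^bsub>SR\<^esub> \<oplus>\<^bsub>SR\<^esub> X1 \<otimes>\<^bsub>SR\<^esub> X3 \<otimes>\<^bsub>SR\<^esub> X2 = \<zero>\<^bsub>SR\<^esub>"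
proof -
  have "SR_proj p = \<zero>\<^bsub>SR\<^esub>" if "p \<in> rel_ideal" for p
    using that ring.a_rcos_zero[OF ring_free_ring rel_ideal]
    by (simp add: SR_proj_def SR_def FactRing_def)
  from this[OF rel_ideal_memI(1)] this[OF rel_ideal_memI(2)] this[OF rel_ideal_memI(3)]
  show "\<one>\<^bsub>SR\<^esub> \<oplus>\<^bsub>SR\<^esub> X3 \<otimes>\<^bsub>SR\<^esub> X2 \<otimes>\<^bsub>SR\<^esub> X1 = \<zero>\<^bsub>SR\<^esub>"
    "\<one>\<^bsub>SR\<^esub> \<oplus>\<^bsub>SR\<^esub> X2 \<otimes>\<^bsub>SR\<^esub> X1 \<otimes>\<^bsub>SR\<^esub> X3 = \<zero>\<^bsub>SR\<^esub>"
    "\<one>\<^bsub>SR\<^esub> \<oplus>\<^bsub>SR\<^esub> X1 \<otimes>\<^bsub>SR\<^esub> X3 \<otimes>\<^bsub>SR\<^esub> X2 = \<zero>\<^bsub>SR\<^esub>"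
    by (simp_all add: SR_proj_simps SR_proj_ncvar)
qed

text \<open>Evaluation at \<open>f\<close> kills the three generators of \<open>rel_ideal\<close>,
  hence the whole ideal, and is therefore constant on cosets.\<close>

lemma SR_lift:
  assumes R: "ring R" and f: "\<And>i. f i \<in> carrier R"
    and rel: "\<one>\<^bsub>R\<^esub> \<oplus>\<^bsub>R\<^esub> f V3 \<otimes>\<^bsub>R\<^esub> f V2 \<otimes>\<^bsub>R\<^esub> f V1 = \<zero>\<^bsub>R\<^esub>"
      "\<one>\<^bsub>R\<^esub> \<oplus>\<^bsub>R\<^esub> f V2 \<otimes>\<^bsub>R\<^esub> f V1 \<otimes>\<^bsub>R\<^esub> f V3 = \<zero>\<^bsub>R\<^esub>"
      "\<one>\<^bsub>R\<^esub> \<oplus>\<^bsub>R\<^esub> f V1 \<otimes>\<^bsub>R\<^esub> f V3 \<otimes>\<^bsub>R\<^esub> f V2 = \<zero>\<^bsub>R\<^esub>"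
  obtains h where "h \<in> ring_hom SR R" "\<And>i. h (coef i) = f i"
proof -
  interpret R: ring R by (rule R)
  define k where "k = R.free_eval f"
  interpret k: ring_hom_ring free_ring R k
    unfolding k_def by (intro ring_hom_ringI2 ring_free_ring R R.free_eval_hom f)
  have k_var: "k (ncvar i) = f i" for i
    unfolding k_def by (rule R.free_eval_ncvar) (rule f)
  have "k 1 = \<one>\<^bsub>R\<^esub>" "k (p + q) = k p \<oplus>\<^bsub>R\<^esub> k q" "k (p * q) = k p \<otimes>\<^bsub>R\<^esub> k q" "k p \<in> carrier R" for p q
    using k.hom_one k.hom_add[of p q] k.hom_mult[of p q] k.hom_closed[of p] by simp_all
  note k_simps = this
  have "rel_ideal \<subseteq> a_kernel free_ring R k"
    unfolding rel_ideal_def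
    by (rule ring.genideal_minimal[OF ring_free_ring k.kernel_is_ideal])
      (simp_all only: a_kernel_def' k_simps(1-3) k_var rel free_ring_simps insert_subset
        mem_Collect_eq empty_subsetI UNIV_I simp_thms)
  then have k_rel: "k p = \<zero>\<^bsub>R\<^esub>" if "p \<in> rel_ideal" for p
    using that by (simp only: a_kernel_def' subset_iff mem_Collect_eq)
  have k_image: "k ` SR_proj p = {k p}" for p
  proof -
    have "k (r + p) = k p" if "r \<in> rel_ideal" for r
      using that by (simp add: k_simps k_rel)
    moreover have "SR_proj p = (\<lambda>r. r + p) ` rel_ideal"
      by (auto simp: SR_proj_def a_r_coset_def')
    moreover have "rel_ideal \<noteq> {}"
      using rel_ideal_memI by auto
    ultimately show ?thesis by (auto simp: image_image)
  qed
  \<comment> \<open>Elements of \<open>SR\<close> are cosets, and the image of a coset under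
    \<open>k\<close> is a singleton whose element is the wanted value.\<close>
  define h where "h = (\<lambda>A. the_elem (k ` A))"
  have h_proj: "h (SR_proj p) = k p" for p
    by (simp add: h_def k_image)
  have "h \<in> ring_hom SR R"
  proof (rule ring_hom_memI)
    show "h \<one>\<^bsub>SR\<^esub> = \<one>\<^bsub>R\<^esub>"
      using h_proj[of 1] by (simp add: k_simps(1) SR_proj_simps)
  next
    fix a b assume "a \<in> carrier SR" "b \<in> carrier SR"
    then obtain p q where pq: "a = SR_proj p" "b = SR_proj q"
      by (auto simp: carrier_SR)
    show "h a \<in> carrier R"
      by (simp add: pq h_proj k_simps(4))
    show "h (a \<oplus>\<^bsub>SR\<^esub> b) = h a \<oplus>\<^bsub>R\<^esub> h b" "h (a \<otimes>\<^bsub>SR\<^esub> b) = h a \<otimes>\<^bsub>R\<^esub> h b"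
      by (simp_all only: pq h_proj k_simps(2,3) flip: SR_proj_simps(2,4))
  qed
  moreover have "h (coef i) = f i" for i
    by (simp add: h_proj k_var flip: SR_proj_ncvar)
  ultimately show ?thesis by (rule that)
qed

section \<open>The action of the symmetric group\<close>

lemma ring_hom_inv:
  assumes "ring R" "ring S" "h \<in> ring_hom R S" "x \<in> Units R"
  shows "h x \<in> Units S" "h (inv\<^bsub>R\<^esub> x) = inv\<^bsub>S\<^esub> (h x)"
proof -
  interpret R: ring R by fact
  interpret S: ring S by fact
  have eq: "h x \<otimes>\<^bsub>S\<^esub> h (inv\<^bsub>R\<^esub> x) = \<one>\<^bsub>S\<^esub>" "h (inv\<^bsub>R\<^esub> x) \<otimes>\<^bsub>S\<^esub> h x = \<one>\<^bsub>S\<^esub>"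
    using assms ring_hom_mult[OF assms(3), of x "inv\<^bsub>R\<^esub> x"]
      ring_hom_mult[OF assms(3), of "inv\<^bsub>R\<^esub> x" x] ring_hom_one[OF assms(3)] by auto
  have cl: "h x \<in> carrier S" "h (inv\<^bsub>R\<^esub> x) \<in> carrier S"
    using assms ring_hom_closed[OF assms(3)] by auto
  from eq cl show "h x \<in> Units S" unfolding Units_def by blast
  from S.inv_char[OF cl eq] show "h (inv\<^bsub>R\<^esub> x) = inv\<^bsub>S\<^esub> (h x)" by simp
qed

text \<open>From abc = -1 the element -(bc) is a right inverse of a, and from bca = -1 a left
  inverse.\<close>

lemma (in ring) inv_eq_uminusI:
  assumes "a \<in> carrier R" "b \<in> carrier R" "c \<in> carrier R"
    and "\<one> \<oplus> a \<otimes> b \<otimes> c = \<zero>" and "\<one> \<oplus> b \<otimes> c \<otimes> a = \<zero>"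
  shows "a \<in> Units R" "inv a = \<ominus> (b \<otimes> c)"
proof -
  have "a \<otimes> (b \<otimes> c) = \<ominus> \<one>" "b \<otimes> c \<otimes> a = \<ominus> \<one>"
    using assms minus_equality[of "\<one>" "a \<otimes> b \<otimes> c"] minus_equality[of "\<one>" "b \<otimes> c \<otimes> a"]
    by (metis a_comm m_assoc m_closed one_closed minus_equality)+
  then have eq: "a \<otimes> \<ominus> (b \<otimes> c) = \<one>" "\<ominus> (b \<otimes> c) \<otimes> a = \<one>"
    using assms by (simp_all add: l_minus r_minus minus_minus)
  have cl: "\<ominus> (b \<otimes> c) \<in> carrier R" using assms by simp
  from eq assms cl show "a \<in> Units R" unfolding Units_def by blast
  from inv_char[OF assms(1) cl eq] show "inv a = \<ominus> (b \<otimes> c)" .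
qed

text \<open>The three relations are the cyclic rotations of one product, so every generator stands
  first in one of them and last in another.\<close>

lemmas coef_inverses =
  SR.inv_eq_uminusI[OF coef_closed coef_closed coef_closed SR_relations(3,1)]
  SR.inv_eq_uminusI[OF coef_closed coef_closed coef_closed SR_relations(2,3)]
  SR.inv_eq_uminusI[OF coef_closed coef_closed coef_closed SR_relations(1,2)]

lemma coef_Units [simp, intro]: "coef i \<in> Units SR"
  by (cases i) (simp_all only: coef_inverses)

lemma (in monoid) inv_mult_units:
  assumes "a \<in> Units G" "b \<in> Units G"
  shows "inv (a \<otimes> b) = inv b \<otimes> inv a"
proof (rule inv_char)
  have "a \<otimes> b \<otimes> (inv b \<otimes> inv a) = a \<otimes> (b \<otimes> inv b) \<otimes> inv a"
    using assms by (simp only: m_assoc Units_closed Units_inv_closed m_closed)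
  also have "\<dots> = \<one>" using assms by (simp add: Units_closed)
  finally show "a \<otimes> b \<otimes> (inv b \<otimes> inv a) = \<one>" .
  have "inv b \<otimes> inv a \<otimes> (a \<otimes> b) = inv b \<otimes> (inv a \<otimes> a) \<otimes> b"
    using assms by (simp only: m_assoc Units_closed Units_inv_closed m_closed)
  also have "\<dots> = \<one>" using assms by (simp add: Units_closed)
  finally show "inv b \<otimes> inv a \<otimes> (a \<otimes> b) = \<one>" .
qed (use assms in auto)

text \<open>Inverting cba = -1 reverses the product, and -1 is its own inverse. This form of the
  relations serves the odd permutations.\<close>

lemma (in ring) inverse_relation:
  assumes u: "a \<in> Units R" "b \<in> Units R" "c \<in> Units R" and eq: "\<one> \<oplus> c \<otimes> b \<otimes> a = \<zero>"
  shows "\<one> \<oplus> inv a \<otimes> inv b \<otimes> inv c = \<zero>"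
proof -
  have cba: "c \<otimes> b \<otimes> a = \<ominus> \<one>"
    using u eq by (metis Units_closed a_comm m_closed minus_equality one_closed)
  have "inv a \<otimes> inv b \<otimes> inv c = inv (c \<otimes> b \<otimes> a)"
    using u by (simp add: inv_mult_units m_assoc)
  also have "\<dots> = \<ominus> \<one>"
    unfolding cba by (rule inv_neg_one)
  finally show ?thesis by (simp add: r_neg)
qed

lemmas SR_inverse_relations =
  SR.inverse_relation[OF coef_Units coef_Units coef_Units SR_relations(1)]
  SR.inverse_relation[OF coef_Units coef_Units coef_Units SR_relations(2)]
  SR.inverse_relation[OF coef_Units coef_Units coef_Units SR_relations(3)]

section \<open>The symmetric group on three points\<close>

lemma S3_simps [simp]: "g \<otimes>\<^bsub>S3\<^esub> h = h \<circ> g" "\<one>\<^bsub>S3\<^esub> = id"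
  by (simp_all add: S3_def)

lemma carrier_S3: "carrier S3 = {g. g permutes {1..3}}"
  by (simp add: S3_def)

lemma group_S3: "group S3"
proof (rule groupI)
  fix g assume "g \<in> carrier S3"
  then show "\<exists>h\<in>carrier S3. h \<otimes>\<^bsub>S3\<^esub> g = \<one>\<^bsub>S3\<^esub>"
    by (intro bexI[of _ "inv_into UNIV g"]) (auto simp: carrier_S3 permutes_inv permutes_inv_o)
qed (auto simp: carrier_S3 permutes_compose permutes_id comp_assoc)

lemma S3_closed [simp]:
  "sigma \<in> carrier S3" "tau \<in> carrier S3" "id \<in> carrier S3"
  "\<lbrakk>g \<in> carrier S3; h \<in> carrier S3\<rbrakk> \<Longrightarrow> h \<circ> g \<in> carrier S3"
  by (auto simp: carrier_S3 sigma_def tau_def intro: permutes_swap_id permutes_compose permutes_id)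

lemma sigma_tau_simps [simp]:
  "sigma (Suc 0) = 2" "sigma 2 = 1" "sigma 3 = 3" "tau (Suc 0) = 1" "tau 2 = 3" "tau 3 = 2"
  by (simp_all add: sigma_def tau_def transpose_def)

text \<open>A permutation in \<open>S3\<close> fixes everything outside 1, 2, 3 and is thus given by
  three distinct values. Composition reads opposite to the product of \<open>S3\<close>:
  \<open>tau \<circ> sigma\<close> is first \<open>sigma\<close>, then \<open>tau\<close>.\<close>

lemma S3_cases:
  assumes "g \<in> carrier S3"
  shows "g = id \<or> g = sigma \<or> g = tau \<or> g = tau \<circ> sigma \<or> g = sigma \<circ> tau
      \<or> g = sigma \<circ> tau \<circ> sigma"
proof -
  have 3: "{1..3::nat} = {1, 2, 3}" by auto
  have g: "g permutes {1, 2, 3}"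
    using assms unfolding carrier_S3 3 by simp
  have "g i \<in> {1, 2, 3}" if "i \<in> {1, 2, 3}" for i
    using permutes_in_image[OF g, of i] that by blast
  from this[of 1] this[of 2] this[of 3]
  have v: "g 1 \<in> {1, 2, 3}" "g 2 \<in> {1, 2, 3}" "g 3 \<in> {1, 2, 3}" by simp_all
  have d: "g 1 \<noteq> g 2" "g 1 \<noteq> g 3" "g 2 \<noteq> g 3"
    using inj_eq[OF permutes_inj[OF g]] by simp_all
  have eqI: "g = h" if "h \<in> carrier S3" "g 1 = h 1" "g 2 = h 2" "g 3 = h 3" for h
  proof
    fix i show "g i = h i"
    proof (cases "i \<in> {1, 2, 3}")
      case True with that show ?thesis by auto
    next
      case False
      with that(1) g show ?thesis unfolding carrier_S3 3 by (simp add: permutes_def)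
    qed
  qed
  show ?thesis
    using v d
      eqI[of id] eqI[of sigma] eqI[of tau] eqI[of "tau \<circ> sigma"] eqI[of "sigma \<circ> tau"]
      eqI[of "sigma \<circ> tau \<circ> sigma"]
    by auto
qed

text \<open>The six elements are products of \<open>sigma\<close> and \<open>tau\<close>, the
  identity being the square of \<open>sigma\<close>; hence neither a unit case nor an inverse case
  occurs.\<close>

lemma S3_induct [consumes 1, case_names sigma tau mult]:
  assumes "g \<in> carrier S3" and "P sigma" "P tau"
    and mult: "\<And>g h. \<lbrakk>g \<in> carrier S3; h \<in> carrier S3; P g; P h\<rbrakk> \<Longrightarrow> P (g \<otimes>\<^bsub>S3\<^esub> h)"
  shows "P g"
proof -
  have "P (sigma \<circ> sigma)" "P (tau \<circ> sigma)" "P (sigma \<circ> tau)"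
    using mult[of sigma sigma] mult[of sigma tau] mult[of tau sigma] assms by simp_all
  moreover from this have "P (sigma \<circ> tau \<circ> sigma)"
    using mult[of "tau \<circ> sigma" sigma] assms by (simp add: comp_assoc)
  moreover have "sigma \<circ> sigma = id"
    by (simp add: sigma_def)
  ultimately show ?thesis
    using S3_cases[of g] assms by auto
qed

lemma evenperm_simps [simp]:
  "evenperm sigma = False" "evenperm tau = False" "evenperm (tau \<circ> sigma)" "evenperm (sigma \<circ> tau)"
  "evenperm (sigma \<circ> tau \<circ> sigma) = False"
proof -
  have p: "permutation sigma" "permutation tau"
    by (simp_all add: sigma_def tau_def permutation_swap_id)
  show st: "evenperm sigma = False" "evenperm tau = False"
    by (simp_all add: sigma_def tau_def evenperm_swap)
  show "evenperm (tau \<circ> sigma)" "evenperm (sigma \<circ> tau)" "evenperm (sigma \<circ> tau \<circ> sigma) = False"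
    using p by (simp_all add: evenperm_comp permutation_compose st)
qed

section \<open>The triality automorphisms\<close>

primrec gen_index :: "gen \<Rightarrow> nat"
  where "gen_index V1 = 1" | "gen_index V2 = 2" | "gen_index V3 = 3"

definition gen_at :: "nat \<Rightarrow> gen"
  where "gen_at n = (if n = 1 then V1 else if n = 2 then V2 else V3)"

text \<open>The generators of \<open>S\<^sub>3\<close> act by \<open>X\<^sub>i \<mapsto> X\<^bsub>\<sigma>(i)\<^esub>\<^sup>-\<^sup>1\<close> and \<open>X\<^sub>i \<mapsto> X\<^bsub>\<tau>(i)\<^esub>\<^sup>-\<^sup>1\<close>, so a permutation \<open>g\<close>
  sends \<open>X\<^sub>i\<close> to \<open>X\<^bsub>g(i)\<^esub>\<close> or its inverse, according to the sign of \<open>g\<close>.\<close>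

definition triality_coef :: "(nat \<Rightarrow> nat) \<Rightarrow> gen \<Rightarrow> selt"
  where "triality_coef g i =
    (let x = coef (gen_at (g (gen_index i))) in if evenperm g then x else inv\<^bsub>SR\<^esub> x)"

lemma triality_coef_closed: "triality_coef g i \<in> carrier SR"
  by (simp add: triality_coef_def Let_def)

text \<open>Even permutations rotate the indices and so permute the three relations. Odd ones
  reverse the cyclic order, which the passage to inverses compensates.\<close>

lemma triality_coef_relations:
  assumes "g \<in> carrier S3"
  shows
    "\<one>\<^bsub>SR\<^esub> \<oplus>\<^bsub>SR\<^esub> triality_coef g V3 \<otimes>\<^bsub>SR\<^esub> triality_coef g V2 \<otimes>\<^bsub>SR\<^esub> triality_coef g V1 = \<zero>\<^bsub>SR\<^esub>"
    "\<one>\<^bsub>SR\<^esub> \<oplus>\<^bsub>SR\<^esub> triality_coef g V2 \<otimes>\<^bsub>SR\<^esub> triality_coef g V1 \<otimes>\<^bsub>SR\<^esub> triality_coef g V3 = \<zero>\<^bsub>SR\<^esub>"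
    "\<one>\<^bsub>SR\<^esub> \<oplus>\<^bsub>SR\<^esub> triality_coef g V1 \<otimes>\<^bsub>SR\<^esub> triality_coef g V3 \<otimes>\<^bsub>SR\<^esub> triality_coef g V2 = \<zero>\<^bsub>SR\<^esub>"
proof -
  from S3_cases[OF assms]
  have "(triality_coef g V1, triality_coef g V2, triality_coef g V3) \<in>
      {(X1, X2, X3), (X2, X3, X1), (X3, X1, X2)} \<union>
      {(inv\<^bsub>SR\<^esub> X1, inv\<^bsub>SR\<^esub> X3, inv\<^bsub>SR\<^esub> X2), (inv\<^bsub>SR\<^esub> X2, inv\<^bsub>SR\<^esub> X1, inv\<^bsub>SR\<^esub> X3), (inv\<^bsub>SR\<^esub> X3, inv\<^bsub>SR\<^esub> X2, inv\<^bsub>SR\<^esub> X1)}"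
    by (elim disjE) (simp_all only:, simp_all add: triality_coef_def Let_def gen_at_def)
  then show
    "\<one>\<^bsub>SR\<^esub> \<oplus>\<^bsub>SR\<^esub> triality_coef g V3 \<otimes>\<^bsub>SR\<^esub> triality_coef g V2 \<otimes>\<^bsub>SR\<^esub> triality_coef g V1 = \<zero>\<^bsub>SR\<^esub>"
    "\<one>\<^bsub>SR\<^esub> \<oplus>\<^bsub>SR\<^esub> triality_coef g V2 \<otimes>\<^bsub>SR\<^esub> triality_coef g V1 \<otimes>\<^bsub>SR\<^esub> triality_coef g V3 = \<zero>\<^bsub>SR\<^esub>"
    "\<one>\<^bsub>SR\<^esub> \<oplus>\<^bsub>SR\<^esub> triality_coef g V1 \<otimes>\<^bsub>SR\<^esub> triality_coef g V3 \<otimes>\<^bsub>SR\<^esub> triality_coef g V2 = \<zero>\<^bsub>SR\<^esub>"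
    by (elim UnE insertE emptyE Pair_inject;
        simp only: SR_relations SR_inverse_relations)+
qed

text \<open>For \<open>g\<close> in \<open>S3\<close> such a homomorphism exists by
  \<open>SR_lift\<close> and is unique on the carrier, because the \<open>coef i\<close> generate
  \<open>SR\<close>. The restriction makes it extensional, as \<open>ring_aut_group\<close>
  demands.\<close>

definition triality :: "(nat \<Rightarrow> nat) \<Rightarrow> selt \<Rightarrow> selt"
  where "triality g =
    restrict (SOME h. h \<in> ring_hom SR SR \<and> (\<forall>i. h (coef i) = triality_coef g i)) (carrier SR)"

lemma triality:
  assumes "g \<in> carrier S3"
  shows "triality g \<in> ring_hom SR SR" "triality g (coef i) = triality_coef g i"
proof -
  define h where "h = (SOME h. h \<in> ring_hom SR SR \<and> (\<forall>i. h (coef i) = triality_coef g i))"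
  have "\<exists>h. h \<in> ring_hom SR SR \<and> (\<forall>i. h (coef i) = triality_coef g i)"
    using SR_lift[OF ring_SR triality_coef_closed triality_coef_relations[OF assms]] by metis
  from someI_ex[OF this] have h: "h \<in> ring_hom SR SR" "h (coef i) = triality_coef g i"
    unfolding h_def by auto
  from SR.ring_hom_restrict[OF h(1), of "triality g"] h
  show "triality g \<in> ring_hom SR SR" "triality g (coef i) = triality_coef g i"
    by (auto simp: triality_def h_def)
qed

lemma triality_extensional: "triality g \<in> extensional (carrier SR)"
  by (simp add: triality_def)

lemma SR_hom_extensional_eqI:
  assumes "h \<in> ring_hom SR SR" "k \<in> ring_hom SR SR"
    and "h \<in> extensional (carrier SR)" "k \<in> extensional (carrier SR)"
    and "\<And>i. h (coef i) = k (coef i)"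
  shows "h = k"
proof (rule extensionalityI)
  show "h a = k a" if "a \<in> carrier SR" for a
    using SR_hom_eqI[OF ring_SR assms(1,2,5) that] .
qed (rule assms)+

lemma compose_ring_hom:
  assumes "ring R" and "h \<in> ring_hom R S" "k \<in> ring_hom S T"
  shows "compose (carrier R) k h \<in> ring_hom R T"
proof -
  interpret ring R by fact
  from assms(2,3) show ?thesis by (auto simp: ring_hom_def compose_def Pi_iff)
qed

text \<open>Two homomorphisms need only be compared at the \<open>coef i\<close>. There
  \<open>h\<close> is applied to the index \<open>g\<close> has produced, and the signs multiply
  because homomorphisms preserve inverses.\<close>

lemma triality_mult:
  assumes g: "g \<in> carrier S3" and h: "h \<in> carrier S3"
  shows "triality (g \<otimes>\<^bsub>S3\<^esub> h) = compose (carrier SR) (triality h) (triality g)"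
proof (rule SR_hom_extensional_eqI)
  have gh: "g \<otimes>\<^bsub>S3\<^esub> h \<in> carrier S3"
    using g h by simp
  then show "triality (g \<otimes>\<^bsub>S3\<^esub> h) \<in> ring_hom SR SR" by (rule triality)
  show "compose (carrier SR) (triality h) (triality g) \<in> ring_hom SR SR"
    using compose_ring_hom[OF ring_SR triality(1)[OF g] triality(1)[OF h]] .
  fix i
  have perm: "permutation g" "permutation h"
    using g h by (auto simp: carrier_S3 permutation_permutes)
  have "g (gen_index i) \<in> {1..3}"
    using g permutes_in_image[of g "{1..3}" "gen_index i"] unfolding carrier_S3
    by (cases i) auto
  then have "gen_index (gen_at (g (gen_index i))) = g (gen_index i)"
    by (auto simp: gen_at_def)
  moreover have "evenperm (h \<circ> g) \<longleftrightarrow> evenperm h = evenperm g"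
    using perm by (simp add: evenperm_comp)
  ultimately have "triality h (triality_coef g i) = triality_coef (h \<circ> g) i"
    using ring_hom_inv(2)[OF ring_SR ring_SR triality(1)[OF h] coef_Units]
    by (simp add: triality_coef_def Let_def triality(2)[OF h])
  then show "triality (g \<otimes>\<^bsub>S3\<^esub> h) (coef i) = compose (carrier SR) (triality h) (triality g) (coef i)"
    using triality(2)[OF gh] triality(2)[OF g] by (simp add: compose_def)
qed (simp_all add: triality_extensional)

section \<open>The automorphism group and faithfulness of the action\<close>

lemma group_ring_aut_group:
  assumes "ring R"
  shows "group (ring_aut_group R)"
proof -
  interpret ring R by fact
  have maps: "f a \<in> carrier R" if "f \<in> ring_iso R R" "a \<in> carrier R" for f a
    using that by (auto simp: ring_iso_def intro: ring_hom_closed)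
  show ?thesis
  proof (rule groupI)
    fix f g assume fg: "f \<in> carrier (ring_aut_group R)" "g \<in> carrier (ring_aut_group R)"
    then show "f \<otimes>\<^bsub>ring_aut_group R\<^esub> g \<in> carrier (ring_aut_group R)"
      using bij_betw_compose[of g "carrier R" "carrier R" f "carrier R"]
      by (auto simp: ring_aut_group_def ring_iso_def intro: compose_ring_hom[OF assms]
          bij_betw_compose)
  next
    show "\<one>\<^bsub>ring_aut_group R\<^esub> \<in> carrier (ring_aut_group R)"
      using ring_iso_restrict[OF ring_iso_set_refl, of "\<lambda>x\<in>carrier R. x"]
      by (simp add: ring_aut_group_def)
  next
    fix f assume f: "f \<in> carrier (ring_aut_group R)"
    then show "\<one>\<^bsub>ring_aut_group R\<^esub> \<otimes>\<^bsub>ring_aut_group R\<^esub> f = f"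
      by (auto simp: ring_aut_group_def compose_def extensional_def fun_eq_iff)
    define k where "k = restrict (inv_into (carrier R) f) (carrier R)"
    from f have iso: "f \<in> ring_iso R R" by (simp add: ring_aut_group_def)
    then have bij: "bij_betw f (carrier R) (carrier R)" by (simp add: ring_iso_def)
    have k: "k \<in> carrier (ring_aut_group R)"
      using ring_iso_restrict[OF ring_iso_set_sym[OF assms iso], of k]
      by (simp add: ring_aut_group_def k_def)
    moreover have "k \<otimes>\<^bsub>ring_aut_group R\<^esub> f = \<one>\<^bsub>ring_aut_group R\<^esub>"
      using bij_betw_inv_into_right[OF bij]
      by (auto simp: ring_aut_group_def k_def compose_def fun_eq_iff)
    ultimately show "\<exists>k\<in>carrier (ring_aut_group R). k \<otimes>\<^bsub>ring_aut_group R\<^esub> f = \<one>\<^bsub>ring_aut_group R\<^esub>"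
      by blast
  next
    fix f g h
    assume "f \<in> carrier (ring_aut_group R)" "g \<in> carrier (ring_aut_group R)" "h \<in> carrier (ring_aut_group R)"
    then show "f \<otimes>\<^bsub>ring_aut_group R\<^esub> g \<otimes>\<^bsub>ring_aut_group R\<^esub> h =
        f \<otimes>\<^bsub>ring_aut_group R\<^esub> (g \<otimes>\<^bsub>ring_aut_group R\<^esub> h)"
      by (auto simp: ring_aut_group_def compose_def maps fun_eq_iff)
  qed
qed

interpretation S3: group S3
  by (rule group_S3)

interpretation SR_aut: group "ring_aut_group SR"
  by (rule group_ring_aut_group[OF ring_SR])

lemma ring_aut_group_mult: "f \<otimes>\<^bsub>ring_aut_group R\<^esub> g = compose (carrier R) g f"
  by (simp add: ring_aut_group_def)

lemma triality_id: "triality id = (\<lambda>a\<in>carrier SR. a)"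
proof (rule SR_hom_extensional_eqI)
  show "triality id (coef i) = (\<lambda>a\<in>carrier SR. a) (coef i)" for i
    using triality(2)[of id i] by (cases i) (simp_all add: triality_coef_def Let_def gen_at_def)
qed (use triality(1)[of id] SR_aut.one_closed in
  \<open>simp_all add: triality_extensional ring_aut_group_def ring_iso_def\<close>)

text \<open>By multiplicativity the endomorphism of the inverse permutation is a two-sided inverse,
  which yields bijectivity.\<close>

lemma triality_in_aut:
  assumes g: "g \<in> carrier S3"
  shows "triality g \<in> carrier (ring_aut_group SR)"
proof -
  define k where "k = inv\<^bsub>S3\<^esub> g"
  have k: "k \<in> carrier S3" "g \<otimes>\<^bsub>S3\<^esub> k = id" "k \<otimes>\<^bsub>S3\<^esub> g = id"
    using g S3.r_inv[OF g] S3.l_inv[OF g] by (simp_all add: k_def)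
  have closed: "triality h a \<in> carrier SR" if "h \<in> carrier S3" "a \<in> carrier SR" for h a
    using ring_hom_closed[OF triality(1)] that by blast
  have inverse: "triality k (triality g a) = a" "triality g (triality k a) = a" if "a \<in> carrier SR" for a
    using triality_mult[OF g k(1)] triality_mult[OF k(1) g] that
    unfolding k(2,3) triality_id by (simp_all add: compose_def fun_eq_iff) metis+
  have "bij_betw (triality g) (carrier SR) (carrier SR)"
    by (rule bij_betw_byWitness[of _ "triality k"]) (use g k closed inverse in auto)
  then show ?thesis
    using triality(1)[OF g] triality_extensional by (simp add: ring_aut_group_def ring_iso_def)
qed

text \<open>The evaluation at \<open>X\<^sub>1 = 2\<close>, \<open>X\<^sub>2 = 3\<close>, \<open>X\<^sub>3 = -1/6\<close> takes different values at the six images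
  of \<open>X\<^sub>1\<close>.\<close>

lemma triality_fixing_X1:
  assumes g: "g \<in> carrier S3" and fix_X1: "triality g X1 = X1"
  shows "g = id"
proof -
  define Q where "Q = (ring_of_type_algebra :: rat ring)"
  have Q: "ring Q" unfolding Q_def by (rule ring_of_ring_1)
  have Q_simps [simp]: "carrier Q = UNIV" "\<one>\<^bsub>Q\<^esub> = 1" "\<zero>\<^bsub>Q\<^esub> = 0" "x \<oplus>\<^bsub>Q\<^esub> y = x + y" "x \<otimes>\<^bsub>Q\<^esub> y = x * y" for x y
    by (simp_all add: Q_def ring_of_type_algebra_def)
  \<comment> \<open>Over a commutative ring the three relations all say that the product of the
    values is -1, and 2 * 3 * (-1/6) = -1.\<close>
  define v where "v = (\<lambda>i. if i = V1 then 2 else if i = V2 then 3 else - 1 / 6 :: rat)"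
  obtain e where e: "e \<in> ring_hom SR Q" "\<And>i. e (coef i) = v i"
    by (rule SR_lift[OF Q, of v]) (simp_all add: v_def)
  have e_inv: "e (inv\<^bsub>SR\<^esub> coef i) = 1 / v i" for i
  proof -
    have "v i * e (inv\<^bsub>SR\<^esub> coef i) = 1"
      using ring_hom_mult[OF e(1), of "coef i" "inv\<^bsub>SR\<^esub> coef i"] ring_hom_one[OF e(1)]
      by (simp add: e(2))
    moreover have "v i \<noteq> 0" by (cases i) (simp_all add: v_def)
    ultimately show ?thesis by (simp add: field_simps)
  qed
  have "e (triality_coef g V1) = v V1"
    using fix_X1 triality(2)[OF g] by (simp flip: e(2))
  with S3_cases[OF g] show ?thesis
    by (elim disjE) (simp_all add: triality_coef_def Let_def gen_at_def e(2) e_inv v_def)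
qed

text \<open>Injectivity is \<open>triality_fixing_X1\<close> applied to the kernel. Since
  \<open>sigma\<close> and \<open>tau\<close> generate \<open>S3\<close> and homomorphisms commute
  with generation, the image is the subgroup generated by their images.\<close>

lemma triality_iso:
  "restrict triality (carrier S3) \<in>
    iso S3 (subgroup_generated (ring_aut_group SR) {triality sigma, triality tau})"
proof -
  define \<alpha> where "\<alpha> = restrict triality (carrier S3)"
  interpret \<alpha>: group_hom S3 "ring_aut_group SR" \<alpha>
    by unfold_locales
      (auto simp: hom_def \<alpha>_def triality_in_aut ring_aut_group_mult simp flip: triality_mult)
  have "g \<in> generate S3 {sigma, tau}" if "g \<in> carrier S3" for g
    using that
  proof (induction rule: S3_induct)
    case (mult g h)
    then show ?case by (intro generate.eng)
  qed (auto intro: generate.incl)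
  then have generated: "generate S3 {sigma, tau} = carrier S3"
    using S3.generate_in_carrier[of "{sigma, tau}"] by auto
  have "\<alpha> ` carrier S3 = generate (ring_aut_group SR) {triality sigma, triality tau}"
    using \<alpha>.generate_img[of "{sigma, tau}"] unfolding generated by (simp add: \<alpha>_def)
  moreover have "inj_on \<alpha> (carrier S3)"
    unfolding \<alpha>.inj_on_one_iff
    by (auto simp: \<alpha>_def ring_aut_group_def intro!: triality_fixing_X1)
  ultimately show ?thesis
    using \<alpha>.homh triality_in_aut
    by (simp add: iso_def hom_def bij_betw_def carrier_subgroup_generated subgroup_generated_def flip: \<alpha>_def)
      (auto simp: generate.incl)
qed

section \<open>Existence and uniqueness of the action\<close>

lemma triality_generators:
  "triality sigma X1 = inv\<^bsub>SR\<^esub> X2" "triality sigma X2 = inv\<^bsub>SR\<^esub> X1" "triality sigma X3 = inv\<^bsub>SR\<^esub> X3"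
  "triality tau X1 = inv\<^bsub>SR\<^esub> X1" "triality tau X2 = inv\<^bsub>SR\<^esub> X3" "triality tau X3 = inv\<^bsub>SR\<^esub> X2"
  by (simp_all add: triality triality_coef_def gen_at_def)

lemma generated_S3_action_triality: "generated_S3_action (restrict triality (carrier S3))"
  using triality_iso by (simp add: generated_S3_action_def triality_generators triality_in_aut)

text \<open>The prescribed values at the generators of \<open>SR\<close> determine
  \<open>\<alpha> sigma\<close> and \<open>\<alpha> tau\<close>; multiplicativity then determines
  \<open>\<alpha>\<close> on all of \<open>S3\<close>.\<close>

lemma generated_S3_action_unique:
  assumes "generated_S3_action \<alpha>"
  shows "\<alpha> = restrict triality (carrier S3)"
proof (rule extensionalityI)
  have eqI: "f = triality g"
    if "f \<in> carrier (ring_aut_group SR)" "g \<in> carrier S3" "\<And>i. f (coef i) = triality g (coef i)" for f g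
    using that triality_in_aut[of g]
    by (intro SR_hom_extensional_eqI) (auto simp: ring_aut_group_def ring_iso_def)
  fix g assume "g \<in> carrier S3"
  then have "\<alpha> g = triality g"
  proof (induction rule: S3_induct)
    case sigma
    show ?case
    proof (rule eqI)
      show "\<alpha> sigma (coef i) = triality sigma (coef i)" for i
        using assms by (cases i) (simp_all add: generated_S3_action_def triality_generators)
    qed (use assms in \<open>simp_all add: generated_S3_action_def\<close>)
  next
    case tau
    show ?case
    proof (rule eqI)
      show "\<alpha> tau (coef i) = triality tau (coef i)" for i
        using assms by (cases i) (simp_all add: generated_S3_action_def triality_generators)
    qed (use assms in \<open>simp_all add: generated_S3_action_def\<close>)
  next
    case (mult g h)
    have "\<alpha> (g \<otimes>\<^bsub>S3\<^esub> h) = \<alpha> g \<otimes>\<^bsub>ring_aut_group SR\<^esub> \<alpha> h"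
      using assms mult.hyps unfolding generated_S3_action_def iso_def hom_def subgroup_generated_def
      by simp
    with mult show ?case
      by (simp only: triality_mult ring_aut_group_mult)
  qed
  with \<open>g \<in> carrier S3\<close> show "\<alpha> g = restrict triality (carrier S3) g" by simp
qed (use assms in \<open>simp_all add: generated_S3_action_def\<close>)

section \<open>Endomorphism rings and right modules\<close>

text \<open>As for permutations and automorphisms, \<open>f \<otimes> g\<close> is first \<open>f\<close>, then \<open>g\<close>, so that ring
  homomorphisms into this ring are right actions.\<close>

definition end_ring :: "('a, 'm) ring_scheme \<Rightarrow> ('a \<Rightarrow> 'a) ring"
  where "end_ring G =
    \<lparr>carrier = {f \<in> carrier G \<rightarrow>\<^sub>E carrier G.
       \<forall>x\<in>carrier G. \<forall>y\<in>carrier G. f (x \<oplus>\<^bsub>G\<^esub> y) = f x \<oplus>\<^bsub>G\<^esub> f y},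
     monoid.mult = (\<lambda>f g. compose (carrier G) g f),
     one = (\<lambda>x\<in>carrier G. x),
     ring.zero = (\<lambda>x\<in>carrier G. \<zero>\<^bsub>G\<^esub>),
     add = (\<lambda>f g. \<lambda>x\<in>carrier G. f x \<oplus>\<^bsub>G\<^esub> g x)\<rparr>"

lemma carrier_end_ring:
  "f \<in> carrier (end_ring G) \<longleftrightarrow> f \<in> carrier G \<rightarrow>\<^sub>E carrier G \<and>
    (\<forall>x\<in>carrier G. \<forall>y\<in>carrier G. f (x \<oplus>\<^bsub>G\<^esub> y) = f x \<oplus>\<^bsub>G\<^esub> f y)"
  by (simp add: end_ring_def)

lemma end_ring_simps:
  "f \<otimes>\<^bsub>end_ring G\<^esub> g = compose (carrier G) g f"
  "\<one>\<^bsub>end_ring G\<^esub> = (\<lambda>x\<in>carrier G. x)"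
  "\<zero>\<^bsub>end_ring G\<^esub> = (\<lambda>x\<in>carrier G. \<zero>\<^bsub>G\<^esub>)"
  "f \<oplus>\<^bsub>end_ring G\<^esub> g = (\<lambda>x\<in>carrier G. f x \<oplus>\<^bsub>G\<^esub> g x)"
  by (simp_all add: end_ring_def)

lemma (in abelian_group) ring_end_ring: "ring (end_ring G)"
proof (rule ringI)
  have closed: "f x \<in> carrier G" if "f \<in> carrier (end_ring G)" "x \<in> carrier G" for f x
    using that by (auto simp: carrier_end_ring)
  have ext: "f \<in> extensional (carrier G)" if "f \<in> carrier (end_ring G)" for f
    using that by (auto simp: carrier_end_ring PiE_def)
  have additive: "f (x \<oplus> y) = f x \<oplus> f y" if "f \<in> carrier (end_ring G)" "x \<in> carrier G" "y \<in> carrier G" for f x y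
    using that by (auto simp: carrier_end_ring)
  show "abelian_group (end_ring G)"
  proof (rule abelian_groupI)
    fix f assume f: "f \<in> carrier (end_ring G)"
    show "\<exists>g\<in>carrier (end_ring G). g \<oplus>\<^bsub>end_ring G\<^esub> f = \<zero>\<^bsub>end_ring G\<^esub>"
    proof
      show "(\<lambda>x\<in>carrier G. \<ominus> f x) \<in> carrier (end_ring G)"
        using f closed additive by (auto simp: carrier_end_ring minus_add)
      show "(\<lambda>x\<in>carrier G. \<ominus> f x) \<oplus>\<^bsub>end_ring G\<^esub> f = \<zero>\<^bsub>end_ring G\<^esub>"
        using f closed by (simp add: end_ring_simps l_neg fun_eq_iff)
    qed
    show "\<zero>\<^bsub>end_ring G\<^esub> \<oplus>\<^bsub>end_ring G\<^esub> f = f"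
      using closed[OF f] extensional_arb[OF ext[OF f]] by (simp add: end_ring_simps fun_eq_iff)
  next
    fix f g assume fg: "f \<in> carrier (end_ring G)" "g \<in> carrier (end_ring G)"
    show "f \<oplus>\<^bsub>end_ring G\<^esub> g \<in> carrier (end_ring G)"
      using closed[OF fg(1)] closed[OF fg(2)] additive[OF fg(1)] additive[OF fg(2)]
      by (auto simp: carrier_end_ring end_ring_simps a_ac)
    show "f \<oplus>\<^bsub>end_ring G\<^esub> g = g \<oplus>\<^bsub>end_ring G\<^esub> f"
      unfolding end_ring_simps
      by (rule restrict_ext) (rule a_comm[OF closed[OF fg(1)] closed[OF fg(2)]])
    fix h assume h: "h \<in> carrier (end_ring G)"
    show "f \<oplus>\<^bsub>end_ring G\<^esub> g \<oplus>\<^bsub>end_ring G\<^esub> h = f \<oplus>\<^bsub>end_ring G\<^esub> (g \<oplus>\<^bsub>end_ring G\<^esub> h)"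
      using closed[OF fg(1)] closed[OF fg(2)] closed[OF h]
      unfolding end_ring_simps by (intro restrict_ext) (simp add: a_assoc)
  qed (auto simp: carrier_end_ring end_ring_simps)
  show "monoid (end_ring G)"
  proof (rule monoidI)
    fix f assume f: "f \<in> carrier (end_ring G)"
    show "\<one>\<^bsub>end_ring G\<^esub> \<otimes>\<^bsub>end_ring G\<^esub> f = f" "f \<otimes>\<^bsub>end_ring G\<^esub> \<one>\<^bsub>end_ring G\<^esub> = f"
      using closed[OF f] extensional_arb[OF ext[OF f]]
      by (simp_all add: end_ring_simps compose_def fun_eq_iff)
    fix g assume g: "g \<in> carrier (end_ring G)"
    show "f \<otimes>\<^bsub>end_ring G\<^esub> g \<in> carrier (end_ring G)"
      using closed[OF f] closed[OF g] additive[OF f] additive[OF g]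
      by (auto simp: carrier_end_ring end_ring_simps compose_def)
    fix h assume h: "h \<in> carrier (end_ring G)"
    show "f \<otimes>\<^bsub>end_ring G\<^esub> g \<otimes>\<^bsub>end_ring G\<^esub> h = f \<otimes>\<^bsub>end_ring G\<^esub> (g \<otimes>\<^bsub>end_ring G\<^esub> h)"
      using closed[OF f] by (simp add: end_ring_simps compose_def fun_eq_iff)
  qed (auto simp: carrier_end_ring end_ring_simps)
  fix f g h assume f: "f \<in> carrier (end_ring G)" and g: "g \<in> carrier (end_ring G)"
    and h: "h \<in> carrier (end_ring G)"
  show "(f \<oplus>\<^bsub>end_ring G\<^esub> g) \<otimes>\<^bsub>end_ring G\<^esub> h = f \<otimes>\<^bsub>end_ring G\<^esub> h \<oplus>\<^bsub>end_ring G\<^esub> g \<otimes>\<^bsub>end_ring G\<^esub> h"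
    using closed[OF f] closed[OF g] additive[OF h]
    by (simp add: end_ring_simps compose_def fun_eq_iff)
  show "h \<otimes>\<^bsub>end_ring G\<^esub> (f \<oplus>\<^bsub>end_ring G\<^esub> g) = h \<otimes>\<^bsub>end_ring G\<^esub> f \<oplus>\<^bsub>end_ring G\<^esub> h \<otimes>\<^bsub>end_ring G\<^esub> g"
    using closed[OF h] by (simp add: end_ring_simps compose_def fun_eq_iff)
qed

definition rmodule_of_hom :: "('a, 'm) ring_scheme \<Rightarrow> ('r \<Rightarrow> 'a \<Rightarrow> 'a) \<Rightarrow> ('r, 'a) rmodule"
  where "rmodule_of_hom G \<rho> =
    \<lparr>carrier = carrier G, monoid.mult = monoid.mult G, one = \<one>\<^bsub>G\<^esub>, ring.zero = \<zero>\<^bsub>G\<^esub>, add = add G,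
     ract = (\<lambda>x a. \<rho> a x)\<rparr>"

lemma right_module_of_hom:
  assumes R: "ring R" and G: "abelian_group G" and \<rho>: "\<rho> \<in> ring_hom R (end_ring G)"
  shows "right_module R (rmodule_of_hom G \<rho>)"
proof -
  interpret G: abelian_group G by fact
  interpret ring R by fact
  have "\<rho> a \<in> carrier (end_ring G)" if "a \<in> carrier R" for a
    using that ring_hom_closed[OF \<rho>] by blast
  moreover have "abelian_group (rmodule_of_hom G \<rho>)"
    by (rule abelian_groupI)
      (auto simp: rmodule_of_hom_def G.a_ac intro: G.l_neg)
  ultimately show ?thesis
    using R \<rho>
    by (auto simp: right_module_def right_module_axioms_def rmodule_of_hom_def carrier_end_ring
        ring_hom_add ring_hom_mult ring_hom_one end_ring_simps compose_def)
qed

section \<open>Elementary laws of right modules\<close>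

context right_module
begin

lemma ract_zero: "a \<in> carrier R \<Longrightarrow> \<zero>\<^bsub>M\<^esub> \<star>\<^bsub>M\<^esub> a = \<zero>\<^bsub>M\<^esub>"
  using ract_add_vector[of "\<zero>\<^bsub>M\<^esub>" "\<zero>\<^bsub>M\<^esub>" a] ract_closed[of "\<zero>\<^bsub>M\<^esub>" a]
  by (metis M.add.r_cancel_one M.zero_closed M.l_zero)

lemma ract_zero_scalar: "x \<in> carrier M \<Longrightarrow> x \<star>\<^bsub>M\<^esub> \<zero>\<^bsub>R\<^esub> = \<zero>\<^bsub>M\<^esub>"
  using ract_add_scalar[of x "\<zero>\<^bsub>R\<^esub>" "\<zero>\<^bsub>R\<^esub>"] ract_closed[of x "\<zero>\<^bsub>R\<^esub>"]
  by (metis M.add.r_cancel_one R.zero_closed R.l_zero)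

lemma ract_uminus:
  "\<lbrakk>x \<in> carrier M; a \<in> carrier R\<rbrakk> \<Longrightarrow> (\<ominus>\<^bsub>M\<^esub> x) \<star>\<^bsub>M\<^esub> a = \<ominus>\<^bsub>M\<^esub> (x \<star>\<^bsub>M\<^esub> a)"
  by (rule M.minus_equality[symmetric])
    (simp_all add: ract_closed M.l_neg ract_zero flip: ract_add_vector)

lemma ract_uminus_scalar:
  "\<lbrakk>x \<in> carrier M; a \<in> carrier R\<rbrakk> \<Longrightarrow> x \<star>\<^bsub>M\<^esub> (\<ominus>\<^bsub>R\<^esub> a) = \<ominus>\<^bsub>M\<^esub> (x \<star>\<^bsub>M\<^esub> a)"
  by (rule M.minus_equality[symmetric])
    (simp_all add: ract_closed R.l_neg ract_zero_scalar flip: ract_add_scalar)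

lemma ract_inverse:
  assumes "x \<in> carrier M" "a \<in> Units R"
  shows "x \<star>\<^bsub>M\<^esub> a \<star>\<^bsub>M\<^esub> inv\<^bsub>R\<^esub> a = x" "x \<star>\<^bsub>M\<^esub> inv\<^bsub>R\<^esub> a \<star>\<^bsub>M\<^esub> a = x"
  using assms ract_mult[of x a "inv\<^bsub>R\<^esub> a"] ract_mult[of x "inv\<^bsub>R\<^esub> a" a]
  by (simp_all add: ract_one R.Units_closed)

end

section \<open>The module of a central pique\<close>

locale central =
  fixes Q :: "'a pique"
  assumes central: "central_pique Q"
begin

sublocale pique Q
  using central by (simp add: central_pique_def)

abbreviation m where "m \<equiv> qmult Q"
abbreviation r where "r \<equiv> rdiv Q"
abbreviation l where "l \<equiv> ldiv Q"
abbreviation e where "e \<equiv> point Q"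
abbreviation A where "A \<equiv> carrier Q"

section \<open>Centrality and the Mal'cev term\<close>

lemmas closed [simp] = qmult_closed rdiv_closed ldiv_closed point_closed

lemma point_idems [simp]: "m e e = e" "r e e = e" "l e e = e"
  using point_idem rdiv_qmult[of e e] ldiv_qmult[of e e] by simp_all

text \<open>The standard Mal'cev term of quasigroups. In the module to be constructed it becomes x -
  y + z.\<close>

definition malcev :: "'a \<Rightarrow> 'a \<Rightarrow> 'a \<Rightarrow> 'a"
  where "malcev x y z = m (r x (l y y)) (l y z)"

lemma malcev_closed [simp]: "\<lbrakk>x \<in> A; y \<in> A; z \<in> A\<rbrakk> \<Longrightarrow> malcev x y z \<in> A"
  by (simp add: malcev_def)

lemma malcev_right: "\<lbrakk>x \<in> A; y \<in> A\<rbrakk> \<Longrightarrow> malcev x y y = x"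
  using qmult_rdiv[of "l y y" x] by (simp add: malcev_def)

lemma malcev_left: "\<lbrakk>y \<in> A; z \<in> A\<rbrakk> \<Longrightarrow> malcev y y z = z"
  using rdiv_qmult[of "l y y" y] qmult_ldiv[of y y] qmult_ldiv[of y z] by (simp add: malcev_def)

text \<open>Morally two pairs are congruent iff their differences x - y and z - w agree. Before a
  subtraction is available, z = x - y + w is expressed by the Mal'cev term.\<close>

lemma malcev_graph_congruence:
  obtains \<theta> where "pique_congruence (pique_prod Q Q) \<theta>"
    and "\<And>x y z w. \<lbrakk>x \<in> A; y \<in> A; z \<in> A; w \<in> A\<rbrakk> \<Longrightarrow> ((x, y), (z, w)) \<in> \<theta> \<longleftrightarrow> z = malcev x y w"
proof -
  obtain \<theta> where cong: "pique_congruence (pique_prod Q Q) \<theta>"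
    and diag: "{(x, x) | x. x \<in> A} \<in> carrier (pique_prod Q Q) // \<theta>"
    using central by (auto simp: central_pique_def normal_subpique_def)
  have equiv: "equiv (A \<times> A) \<theta>"
    using cong by (simp add: pique_congruence_def pique_prod_def)
  then have refl: "(p, p) \<in> \<theta>" if "p \<in> A \<times> A" for p
    using that by (auto simp: equiv_def refl_on_def)
  have sym: "(q, p) \<in> \<theta>" if "(p, q) \<in> \<theta>" for p q
    using equiv that by (auto simp: equiv_def elim: symE)
  have trans: "(p, s) \<in> \<theta>" if "(p, q) \<in> \<theta>" "(q, s) \<in> \<theta>" for p q s
    using equiv that by (auto simp: equiv_def elim: transE)
  obtain p where p: "p \<in> A \<times> A" "{(x, x) | x. x \<in> A} = \<theta> `` {p}"
    using diag by (auto simp: quotient_def pique_prod_def)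
  have diag_class: "((x, x), (y, z)) \<in> \<theta> \<longleftrightarrow> y = z" if "x \<in> A" "y \<in> A" "z \<in> A" for x y z
  proof -
    have "(p, (x, x)) \<in> \<theta>" using p that by blast
    then have "((x, x), (y, z)) \<in> \<theta> \<longleftrightarrow> (p, (y, z)) \<in> \<theta>"
      using sym trans by blast
    also have "\<dots> \<longleftrightarrow> (y, z) \<in> {(x, x) | x. x \<in> A}"
      unfolding p(2) by blast
    finally show ?thesis using that by auto
  qed
  have ops: "((m a b, m a' b'), (m c d, m c' d')) \<in> \<theta>" "((r a b, r a' b'), (r c d, r c' d')) \<in> \<theta>"
      "((l a b, l a' b'), (l c d, l c' d')) \<in> \<theta>"
    if "((a, a'), (c, c')) \<in> \<theta>" "((b, b'), (d, d')) \<in> \<theta>" for a b c d a' b' c' d'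
    using cong that unfolding pique_congruence_def pique_prod_def by fastforce+
  have malcev_cong: "((malcev a b c, malcev a' b' c'), (malcev x y z, malcev x' y' z')) \<in> \<theta>"
    if "((a, a'), (x, x')) \<in> \<theta>" "((b, b'), (y, y')) \<in> \<theta>" "((c, c'), (z, z')) \<in> \<theta>"
    for a b c x y z a' b' c' x' y' z'
    unfolding malcev_def by (intro ops that)
  \<comment> \<open>Apply the term to the congruent pairs (x,y) ~ (x,y), (y,y) ~ (y,y) and (y,y) ~
    (w,w), the last of which lies in the diagonal class.\<close>
  have graph: "((x, y), (malcev x y w, w)) \<in> \<theta>" if "x \<in> A" "y \<in> A" "w \<in> A" for x y w
    using malcev_cong[of x y x y y y y y y y w w] refl diag_class[of y w w] that
    by (simp add: malcev_left malcev_right)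
  have unique: "z = z'" if "x \<in> A" "y \<in> A" "z \<in> A" "z' \<in> A" "w \<in> A"
    "((x, y), (z, w)) \<in> \<theta>" "((x, y), (z', w)) \<in> \<theta>" for x y z z' w
  proof -
    have "((z, w), (z', w)) \<in> \<theta>"
      using that sym trans by blast
    \<comment> \<open>Applying the term to (z,w) ~ (z',w) together with the constant pairs (z',w)
      and (z',z') turns the second coordinate into z'. So (z,z') falls into the diagonal
      class.\<close>
    then have "((malcev z z' z', malcev w w z'), (malcev z' z' z', malcev w w z')) \<in> \<theta>"
      using that by (intro malcev_cong refl) auto
    then have "((z', z'), (z, z')) \<in> \<theta>"
      using that sym by (simp add: malcev_left malcev_right)
    then show ?thesis using diag_class that by simp
  qed
  show ?thesis
    by (rule that[OF cong]) (use graph unique in \<open>metis malcev_closed\<close>)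
qed

text \<open>A function commutes with the operations as soon as its graph is closed under them, and
  here the graph is a congruence.\<close>

lemma malcev_hom:
  assumes "x \<in> A" "y \<in> A" "z \<in> A" "x' \<in> A" "y' \<in> A" "z' \<in> A"
  shows "malcev (m x x') (m y y') (m z z') = m (malcev x y z) (malcev x' y' z')"
    and "malcev (r x x') (r y y') (r z z') = r (malcev x y z) (malcev x' y' z')"
    and "malcev (l x x') (l y y') (l z z') = l (malcev x y z) (malcev x' y' z')"
proof -
  obtain \<theta> where cong: "pique_congruence (pique_prod Q Q) \<theta>"
    and graph: "\<And>x y z w. \<lbrakk>x \<in> A; y \<in> A; z \<in> A; w \<in> A\<rbrakk> \<Longrightarrow> ((x, y), (z, w)) \<in> \<theta> \<longleftrightarrow> z = malcev x y w"
    by (rule malcev_graph_congruence) blast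
  have "((x, y), (malcev x y z, z)) \<in> \<theta>" "((x', y'), (malcev x' y' z', z')) \<in> \<theta>"
    using assms graph by simp_all
  then have "((m x x', m y y'), (m (malcev x y z) (malcev x' y' z'), m z z')) \<in> \<theta> \<and>
      ((r x x', r y y'), (r (malcev x y z) (malcev x' y' z'), r z z')) \<in> \<theta> \<and>
      ((l x x', l y y'), (l (malcev x y z) (malcev x' y' z'), l z z')) \<in> \<theta>"
    using cong unfolding pique_congruence_def pique_prod_def by fastforce
  then show "malcev (m x x') (m y y') (m z z') = m (malcev x y z) (malcev x' y' z')"
    "malcev (r x x') (r y y') (r z z') = r (malcev x y z) (malcev x' y' z')"
    "malcev (l x x') (l y y') (l z z') = l (malcev x y z) (malcev x' y' z')"
    using assms graph by simp_all
qed

section \<open>The abelian group of a central pique\<close>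

definition padd :: "'a \<Rightarrow> 'a \<Rightarrow> 'a"
  where "padd x y = m (r x e) (l e y)"

lemma padd_eq_mal: "padd x y = malcev x e y"
  by (simp add: padd_def malcev_def)

lemma padd_closed [simp]: "\<lbrakk>x \<in> A; y \<in> A\<rbrakk> \<Longrightarrow> padd x y \<in> A"
  by (simp add: padd_def)

lemma padd_point [simp]: "x \<in> A \<Longrightarrow> padd e x = x" "x \<in> A \<Longrightarrow> padd x e = x"
  by (simp_all add: padd_eq_mal malcev_left malcev_right)

text \<open>The case of \<open>malcev_hom\<close> with middle arguments \<open>e\<close>, which is
  idempotent for all three operations.\<close>

lemma padd_hom:
  assumes "x \<in> A" "x' \<in> A" "z \<in> A" "z' \<in> A"
  shows "padd (m x x') (m z z') = m (padd x z) (padd x' z')"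
    and "padd (r x x') (r z z') = r (padd x z) (padd x' z')"
    and "padd (l x x') (l z z') = l (padd x z) (padd x' z')"
  using malcev_hom[of x e z x' e z'] assms by (simp_all add: padd_eq_mal)

text \<open>Eckmann--Hilton: \<open>padd\<close> is itself composed of the operations, so it commutes
  with itself.\<close>

lemma padd_medial:
  assumes "a \<in> A" "b \<in> A" "c \<in> A" "d \<in> A"
  shows "padd (padd a b) (padd c d) = padd (padd a c) (padd b d)"
proof -
  have "padd (padd a b) (padd c d) = padd (m (r a e) (l e b)) (m (r c e) (l e d))"
    by (simp add: padd_def)
  also have "\<dots> = m (padd (r a e) (r c e)) (padd (l e b) (l e d))"
    using assms by (simp add: padd_hom)
  also have "\<dots> = m (r (padd a c) (padd e e)) (l (padd e e) (padd b d))"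
    using assms by (simp only: padd_hom closed)
  also have "\<dots> = padd (padd a c) (padd b d)"
    by (simp only: padd_point point_closed) (simp add: padd_def)
  finally show ?thesis .
qed

text \<open>In the medial law, zeros in the two outer places exchange the inner terms; a zero in the
  third place, used next, gives associativity.\<close>

lemma padd_comm: "\<lbrakk>x \<in> A; y \<in> A\<rbrakk> \<Longrightarrow> padd x y = padd y x"
  using padd_medial[of e x y e] by simp

lemma padd_assoc: "\<lbrakk>x \<in> A; y \<in> A; z \<in> A\<rbrakk> \<Longrightarrow> padd (padd x y) z = padd x (padd y z)"
  using padd_medial[of x y e z] by simp

lemma padd_mal:
  assumes "x \<in> A" "y \<in> A" "z \<in> A" "x' \<in> A" "y' \<in> A" "z' \<in> A"
  shows "padd (malcev x y z) (malcev x' y' z') = malcev (padd x x') (padd y y') (padd z z')"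
  using assms by (simp add: malcev_def padd_hom)

text \<open>As \<open>malcev\<close> means x - y + z, the negative of \<open>x\<close> is
  \<open>malcev e x e\<close>. Adding \<open>x = malcev x e e\<close> argument by argument gives
  \<open>malcev x x e = e\<close>.\<close>

lemma padd_inverse: "x \<in> A \<Longrightarrow> padd (malcev e x e) x = e"
  using padd_mal[of e x e x e e] by (simp add: malcev_left malcev_right)

definition pique_group :: "'a ring"
  where "pique_group =
    \<lparr>carrier = A, monoid.mult = padd, one = e, ring.zero = e, add = padd\<rparr>"

lemma pique_group_simps [simp]:
  "carrier pique_group = A" "\<zero>\<^bsub>pique_group\<^esub> = e" "x \<oplus>\<^bsub>pique_group\<^esub> y = padd x y"
  by (simp_all add: pique_group_def)

lemma abelian_group_pique_group: "abelian_group pique_group"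
proof (rule abelian_groupI)
  show "\<exists>y\<in>carrier pique_group. y \<oplus>\<^bsub>pique_group\<^esub> x = \<zero>\<^bsub>pique_group\<^esub>"
    if "x \<in> carrier pique_group" for x
    using that padd_inverse[of x] by (intro bexI[of _ "malcev e x e"]) simp_all
qed (auto simp: padd_assoc intro: padd_comm)

text \<open>The pair (x, y) of arguments is the sum of (x, e) and (e, y), and the operations are
  additive on pairs.\<close>

lemma linear:
  assumes "x \<in> A" "y \<in> A"
  shows "m x y = padd (m x e) (m e y)" "r x y = padd (r x e) (r e y)" "l x y = padd (l x e) (l e y)"
  using assms padd_hom[of x e e y] by simp_all

lemma additive:
  assumes "x \<in> A" "y \<in> A"
  shows "m (padd x y) e = padd (m x e) (m y e)" "m e (padd x y) = padd (m e x) (m e y)"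
    "l e (padd x y) = padd (l e x) (l e y)" "r e (padd x y) = padd (r e x) (r e y)"
  using assms padd_hom[of x e y e] padd_hom[of e x e y] by simp_all

text \<open>Read from the inside out, these are the relations for \<open>X3 X2 X1\<close>,
  \<open>X2 X1 X3\<close> and \<open>X1 X3 X2\<close>. Each comes from the law (e/u)u = e, which
  linearity splits into two summands.\<close>

lemma coef_relations:
  assumes x: "x \<in> A"
  shows "padd x (l e (m (r e x) e)) = e" "padd x (r e (l e (m x e))) = e"
    "padd x (m (r e (l e x)) e) = e"
proof -
  have split: "padd (m (r e u) e) (m e u) = e" if "u \<in> A" for u
    using that qmult_rdiv[of u e] linear(1)[of "r e u" u] by simp
  have "padd (l e (m (r e x) e)) (l e (m e x)) = l e e"
    using split[OF x] x by (simp flip: additive)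
  then show "padd x (l e (m (r e x) e)) = e"
    using x ldiv_qmult[of e x] by (simp add: padd_comm)
  \<comment> \<open>With u = \<open>l e (m x e)\<close> the summand \<open>m e u\<close> is
    \<open>m x e\<close>. Both summands are then right multiples by \<open>e\<close>, and this
    factor can be cancelled.\<close>
  have "padd (m (r e (l e (m x e))) e) (m x e) = e"
    using split[of "l e (m x e)"] x qmult_ldiv[of e "m x e"] by simp
  then have "m (padd (r e (l e (m x e))) x) e = e"
    using x by (simp add: additive)
  then have "padd (r e (l e (m x e))) x = e"
    using rdiv_qmult[of e "padd (r e (l e (m x e))) x"] x by simp
  then show "padd x (r e (l e (m x e))) = e"
    using x by (simp add: padd_comm)
  show "padd x (m (r e (l e x)) e) = e"
    using split[of "l e x"] x qmult_ldiv[of e x] by (simp add: padd_comm)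
qed

text \<open>With one argument zero, the module formulas reduce to one term; these are the three
  cases in which the remaining scalar is a generator and not an inverse.\<close>

primrec coef_action :: "gen \<Rightarrow> 'a \<Rightarrow> 'a"
  where "coef_action V1 = (\<lambda>x\<in>A. l e x)"
  | "coef_action V2 = (\<lambda>x\<in>A. m x e)"
  | "coef_action V3 = (\<lambda>x\<in>A. r e x)"

section \<open>The action of S on a central pique\<close>

lemma SR_action:
  obtains \<rho> where "\<rho> \<in> ring_hom SR (end_ring pique_group)" "\<And>i. \<rho> (coef i) = coef_action i"
proof -
  let ?E = "end_ring pique_group"
  have relations:
    "\<one>\<^bsub>?E\<^esub> \<oplus>\<^bsub>?E\<^esub> coef_action V3 \<otimes>\<^bsub>?E\<^esub> coef_action V2 \<otimes>\<^bsub>?E\<^esub> coef_action V1 = \<zero>\<^bsub>?E\<^esub>"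
    "\<one>\<^bsub>?E\<^esub> \<oplus>\<^bsub>?E\<^esub> coef_action V2 \<otimes>\<^bsub>?E\<^esub> coef_action V1 \<otimes>\<^bsub>?E\<^esub> coef_action V3 = \<zero>\<^bsub>?E\<^esub>"
    "\<one>\<^bsub>?E\<^esub> \<oplus>\<^bsub>?E\<^esub> coef_action V1 \<otimes>\<^bsub>?E\<^esub> coef_action V3 \<otimes>\<^bsub>?E\<^esub> coef_action V2 = \<zero>\<^bsub>?E\<^esub>"
    by (simp_all add: end_ring_simps compose_def fun_eq_iff coef_relations)
  have "coef_action i \<in> carrier ?E" for i
    by (cases i) (simp_all add: carrier_end_ring additive)
  from SR_lift[OF abelian_group.ring_end_ring[OF abelian_group_pique_group] this relations] that
  show ?thesis by blast
qed

text \<open>Off the carrier of \<open>SR\<close> a homomorphism may take any values, so the action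
  becomes a definite function only by a choice.\<close>

definition module_of_pique :: "(selt, 'a) rmodule"
  where "module_of_pique = rmodule_of_hom pique_group
    (SOME \<rho>. \<rho> \<in> ring_hom SR (end_ring pique_group) \<and> (\<forall>i. \<rho> (coef i) = coef_action i))"

lemma module_of_pique:
  shows "right_module SR module_of_pique"
    and "carrier module_of_pique = A" "\<zero>\<^bsub>module_of_pique\<^esub> = e" "x \<oplus>\<^bsub>module_of_pique\<^esub> y = padd x y"
    and "x \<star>\<^bsub>module_of_pique\<^esub> coef i = coef_action i x"
proof -
  define \<rho> where "\<rho> = (SOME \<rho>. \<rho> \<in> ring_hom SR (end_ring pique_group) \<and> (\<forall>i. \<rho> (coef i) = coef_action i))"
  have "\<exists>\<rho>. \<rho> \<in> ring_hom SR (end_ring pique_group) \<and> (\<forall>i. \<rho> (coef i) = coef_action i)"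
    using SR_action by metis
  from someI_ex[OF this] have \<rho>: "\<rho> \<in> ring_hom SR (end_ring pique_group)" "\<rho> (coef i) = coef_action i"
    by (auto simp flip: \<rho>_def)
  have M: "module_of_pique = rmodule_of_hom pique_group \<rho>"
    by (simp add: module_of_pique_def \<rho>_def)
  show "right_module SR module_of_pique"
    unfolding M by (rule right_module_of_hom[OF ring_SR abelian_group_pique_group \<rho>(1)])
  show "carrier module_of_pique = A" "\<zero>\<^bsub>module_of_pique\<^esub> = e" "x \<oplus>\<^bsub>module_of_pique\<^esub> y = padd x y"
    "x \<star>\<^bsub>module_of_pique\<^esub> coef i = coef_action i x"
    by (simp_all add: M rmodule_of_hom_def \<rho>(2))
qed

end

section \<open>The pique of a module\<close>

lemma coef_inv_closed [simp]: "inv\<^bsub>SR\<^esub> coef i \<in> carrier SR"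
  by simp

lemma X3_eq: "X3 = \<ominus>\<^bsub>SR\<^esub> (inv\<^bsub>SR\<^esub> X1 \<otimes>\<^bsub>SR\<^esub> inv\<^bsub>SR\<^esub> X2)"
proof -
  have "inv\<^bsub>SR\<^esub> (inv\<^bsub>SR\<^esub> X3) = \<ominus>\<^bsub>SR\<^esub> (inv\<^bsub>SR\<^esub> X1 \<otimes>\<^bsub>SR\<^esub> inv\<^bsub>SR\<^esub> X2)"
    using SR_inverse_relations(1,2) by (intro SR.inv_eq_uminusI) simp_all
  then show ?thesis by simp
qed

lemma pique_of_module_simps [simp]:
  "carrier (pique_of_module M) = carrier M" "point (pique_of_module M) = \<zero>\<^bsub>M\<^esub>"
  "qmult (pique_of_module M) x y = x \<star>\<^bsub>M\<^esub> X2 \<oplus>\<^bsub>M\<^esub> y \<star>\<^bsub>M\<^esub> inv\<^bsub>SR\<^esub> X1"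
  "rdiv (pique_of_module M) x y = x \<star>\<^bsub>M\<^esub> inv\<^bsub>SR\<^esub> X2 \<oplus>\<^bsub>M\<^esub> y \<star>\<^bsub>M\<^esub> X3"
  "ldiv (pique_of_module M) x y = x \<star>\<^bsub>M\<^esub> inv\<^bsub>SR\<^esub> X3 \<oplus>\<^bsub>M\<^esub> y \<star>\<^bsub>M\<^esub> X1"
  by (simp_all add: pique_of_module_def)

locale SR_module = right_module SR M for M :: "(selt, 'a) rmodule"
begin

text \<open>As rewrite rules these eliminate \<open>X3\<close> and its inverse, so that the
  quasigroup laws become cancellations. For instance, the term -(x X2 X1) of the left division,
  times the inverse of X1, cancels x X2.\<close>

lemma scalars:
  assumes "x \<in> carrier M"
  shows "x \<star>\<^bsub>M\<^esub> inv\<^bsub>SR\<^esub> X3 = \<ominus>\<^bsub>M\<^esub> (x \<star>\<^bsub>M\<^esub> X2 \<star>\<^bsub>M\<^esub> X1)"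
    and "x \<star>\<^bsub>M\<^esub> X3 = \<ominus>\<^bsub>M\<^esub> (x \<star>\<^bsub>M\<^esub> inv\<^bsub>SR\<^esub> X1 \<star>\<^bsub>M\<^esub> inv\<^bsub>SR\<^esub> X2)"
proof -
  show "x \<star>\<^bsub>M\<^esub> inv\<^bsub>SR\<^esub> X3 = \<ominus>\<^bsub>M\<^esub> (x \<star>\<^bsub>M\<^esub> X2 \<star>\<^bsub>M\<^esub> X1)"
    unfolding coef_inverses(6) using assms by (simp add: ract_uminus_scalar ract_mult)
  have "x \<star>\<^bsub>M\<^esub> (\<ominus>\<^bsub>SR\<^esub> (inv\<^bsub>SR\<^esub> X1 \<otimes>\<^bsub>SR\<^esub> inv\<^bsub>SR\<^esub> X2)) =
      \<ominus>\<^bsub>M\<^esub> (x \<star>\<^bsub>M\<^esub> inv\<^bsub>SR\<^esub> X1 \<star>\<^bsub>M\<^esub> inv\<^bsub>SR\<^esub> X2)"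
    using assms by (simp add: ract_uminus_scalar ract_mult)
  then show "x \<star>\<^bsub>M\<^esub> X3 = \<ominus>\<^bsub>M\<^esub> (x \<star>\<^bsub>M\<^esub> inv\<^bsub>SR\<^esub> X1 \<star>\<^bsub>M\<^esub> inv\<^bsub>SR\<^esub> X2)"
    by (simp only: flip: X3_eq)
qed

lemma pique: "pique (pique_of_module M)"
proof
  fix x y assume "x \<in> carrier (pique_of_module M)" "y \<in> carrier (pique_of_module M)"
  then have xy: "x \<in> carrier M" "y \<in> carrier M" by simp_all
  note simps = ract_closed ract_add_vector ract_uminus ract_inverse scalars
    M.minus_minus M.minus_add M.r_neg1 M.r_neg2 M.l_neg M.r_neg M.a_assoc
  show "qmult (pique_of_module M) x y \<in> carrier (pique_of_module M)"
    "rdiv (pique_of_module M) x y \<in> carrier (pique_of_module M)"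
    "ldiv (pique_of_module M) x y \<in> carrier (pique_of_module M)"
    using xy by (simp_all add: ract_closed)
  show "qmult (pique_of_module M) x (ldiv (pique_of_module M) x y) = y"
    using xy by (simp add: simps)
  show "y = qmult (pique_of_module M) (rdiv (pique_of_module M) y x) x"
    using xy by (simp add: simps)
  show "ldiv (pique_of_module M) x (qmult (pique_of_module M) x y) = y"
    using xy by (simp add: simps)
  show "y = rdiv (pique_of_module M) (qmult (pique_of_module M) y x) x"
    using xy by (simp add: simps)
qed (simp_all add: ract_zero)

text \<open>Linear operations act on differences, so the relation of having equal differences is a
  congruence.\<close>

lemma linear_minus:
  assumes "x \<in> carrier M" "y \<in> carrier M" "x' \<in> carrier M" "y' \<in> carrier M"
    and "C \<in> carrier SR" "D \<in> carrier SR"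
  shows "(x \<star>\<^bsub>M\<^esub> C \<oplus>\<^bsub>M\<^esub> x' \<star>\<^bsub>M\<^esub> D) \<ominus>\<^bsub>M\<^esub> (y \<star>\<^bsub>M\<^esub> C \<oplus>\<^bsub>M\<^esub> y' \<star>\<^bsub>M\<^esub> D) =
    (x \<ominus>\<^bsub>M\<^esub> y) \<star>\<^bsub>M\<^esub> C \<oplus>\<^bsub>M\<^esub> (x' \<ominus>\<^bsub>M\<^esub> y') \<star>\<^bsub>M\<^esub> D"
  using assms by (simp add: M.minus_eq ract_closed ract_add_vector ract_uminus M.minus_add M.a_ac)

text \<open>The congruence x - y = z - w on pairs has the diagonal as its class of (0, 0).\<close>

lemma central: "central_pique (pique_of_module M)"
proof -
  let ?P = "pique_of_module M"
  define \<theta> where "\<theta> = {((x, y), (z, w)). x \<in> carrier M \<and> y \<in> carrier M \<and> z \<in> carrier M \<and>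
    w \<in> carrier M \<and> x \<ominus>\<^bsub>M\<^esub> y = z \<ominus>\<^bsub>M\<^esub> w}"
  have "pique_congruence (pique_prod ?P ?P) \<theta>"
  proof -
    have "equiv (carrier (pique_prod ?P ?P)) \<theta>"
      by (rule equivI) (auto simp: \<theta>_def pique_prod_def refl_on_def sym_def trans_def)
    then show ?thesis
      by (auto simp: pique_congruence_def \<theta>_def pique_prod_def linear_minus ract_closed)
  qed
  moreover have "{(x, x) | x. x \<in> carrier M} \<in> carrier (pique_prod ?P ?P) // \<theta>"
  proof -
    have "z = w" if "z \<in> carrier M" "w \<in> carrier M" "\<zero>\<^bsub>M\<^esub> \<ominus>\<^bsub>M\<^esub> \<zero>\<^bsub>M\<^esub> = z \<ominus>\<^bsub>M\<^esub> w" for z w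
      using that M.minus_equality[of z "\<ominus>\<^bsub>M\<^esub> w"] by (simp add: M.minus_eq M.r_neg)
    then have "{(x, x) | x. x \<in> carrier M} = \<theta> `` {(\<zero>\<^bsub>M\<^esub>, \<zero>\<^bsub>M\<^esub>)}"
      by (auto simp: \<theta>_def M.minus_eq M.r_neg)
    then show ?thesis by (auto simp: quotient_def pique_prod_def)
  qed
  moreover have "subpique {(x, x) | x. x \<in> carrier M} (pique_prod ?P ?P)"
    by (auto simp: subpique_def pique_prod_def ract_closed)
  ultimately show ?thesis
    using pique by (auto simp: central_pique_def normal_subpique_def)
qed

text \<open>The divisions by and of zero multiply by the inverse of X2 and by X1, which the
  multiplication undoes. Hence pique homomorphisms preserve sums.\<close>

lemma additive_from_pique:
  assumes "x \<in> carrier M" "y \<in> carrier M"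
  defines "P \<equiv> pique_of_module M"
  shows "x \<oplus>\<^bsub>M\<^esub> y = qmult P (rdiv P x (point P)) (ldiv P (point P) y)"
  using assms by (simp add: ract_zero ract_inverse ract_closed)

lemma ract_from_pique:
  assumes "x \<in> carrier M"
  defines "P \<equiv> pique_of_module M"
  shows "x \<star>\<^bsub>M\<^esub> X1 = ldiv P (point P) x" "x \<star>\<^bsub>M\<^esub> X2 = qmult P x (point P)"
    "x \<star>\<^bsub>M\<^esub> X3 = rdiv P (point P) x"
  using assms by (simp_all add: ract_zero ract_closed)

end

text \<open>The pique operations are module terms; conversely sums and multiplication by each
  generator of S are pique terms, and the generators suffice.\<close>

lemma rmodule_hom_eq_pique_hom:
  assumes "right_module SR M" "right_module SR N"
  shows "rmodule_hom SR M N = pique_hom (pique_of_module M) (pique_of_module N)"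
proof -
  interpret M: SR_module M using assms by (simp add: SR_module_def)
  interpret N: SR_module N using assms by (simp add: SR_module_def)
  interpret PM: pique "pique_of_module M" by (rule M.pique)
  show ?thesis
  proof (intro equalityI subsetI)
    fix f assume "f \<in> rmodule_hom SR M N"
    then have f: "f \<in> carrier M \<rightarrow>\<^sub>E carrier N"
      "\<And>x y. \<lbrakk>x \<in> carrier M; y \<in> carrier M\<rbrakk> \<Longrightarrow> f (x \<oplus>\<^bsub>M\<^esub> y) = f x \<oplus>\<^bsub>N\<^esub> f y"
      "\<And>x a. \<lbrakk>x \<in> carrier M; a \<in> carrier SR\<rbrakk> \<Longrightarrow> f (x \<star>\<^bsub>M\<^esub> a) = f x \<star>\<^bsub>N\<^esub> a"
      by (auto simp: rmodule_hom_def)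
    have "f \<zero>\<^bsub>M\<^esub> \<in> carrier N" using f(1) by auto
    \<comment> \<open>Zero is preserved because it is itself times the scalar zero.\<close>
    then have "f \<zero>\<^bsub>M\<^esub> = \<zero>\<^bsub>N\<^esub>"
      using f(3)[of "\<zero>\<^bsub>M\<^esub>" "\<zero>\<^bsub>SR\<^esub>"] by (simp add: M.ract_zero N.ract_zero_scalar)
    with f show "f \<in> pique_hom (pique_of_module M) (pique_of_module N)"
      by (simp add: pique_hom_def M.ract_closed)
  next
    fix f assume f: "f \<in> pique_hom (pique_of_module M) (pique_of_module N)"
    define PM where "PM = pique_of_module M"
    define PN where "PN = pique_of_module N"
    have closed: "f x \<in> carrier N" if "x \<in> carrier M" for x
      using f that by (auto simp: pique_hom_def)
    have op_closed: "qmult PM x y \<in> carrier M" "rdiv PM x y \<in> carrier M" "ldiv PM x y \<in> carrier M"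
      if "x \<in> carrier M" "y \<in> carrier M" for x y
      using that by (simp_all add: PM_def M.ract_closed)
    have pt: "point PM \<in> carrier M" by (simp add: PM_def)
    have ops: "f (qmult PM x y) = qmult PN (f x) (f y)" "f (rdiv PM x y) = rdiv PN (f x) (f y)"
      "f (ldiv PM x y) = ldiv PN (f x) (f y)" "f (point PM) = point PN"
      if "x \<in> carrier M" "y \<in> carrier M" for x y
      using f that by (simp_all add: pique_hom_def PM_def PN_def)
    have f_add: "f (x \<oplus>\<^bsub>M\<^esub> y) = f x \<oplus>\<^bsub>N\<^esub> f y" if "x \<in> carrier M" "y \<in> carrier M" for x y
      using that pt closed
      by (simp add: M.additive_from_pique N.additive_from_pique ops op_closed flip: PM_def PN_def)
    have f_uminus: "f (\<ominus>\<^bsub>M\<^esub> x) = \<ominus>\<^bsub>N\<^esub> f x" if "x \<in> carrier M" for x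
      using f_add[of "\<ominus>\<^bsub>M\<^esub> x" x] that closed ops(4)[OF that that]
      by (intro N.minus_equality[symmetric]) (simp_all add: M.l_neg PM_def PN_def)
    \<comment> \<open>The scalars with which \<open>f\<close> commutes form a subring containing the
      generators. The vector stays arbitrary, since for a product \<open>b\<close> acts on
      \<open>x \<star> a\<close>.\<close>
    have "f (x \<star>\<^bsub>M\<^esub> a) = f x \<star>\<^bsub>N\<^esub> a" if "a \<in> carrier SR" "x \<in> carrier M" for a x
      using that
    proof (induction a arbitrary: x rule: SR_induct)
      case one
      then show ?case by (simp add: M.ract_one N.ract_one closed)
    next
      case (coef i)
      then show ?case
        using pt closed
        by (cases i) (simp_all add: M.ract_from_pique N.ract_from_pique ops flip: PM_def PN_def)
    next
      case (add a b)
      then show ?case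
        by (simp add: M.ract_add_scalar N.ract_add_scalar f_add M.ract_closed closed)
    next
      case (uminus a)
      then have "f x \<star>\<^bsub>N\<^esub> (\<ominus>\<^bsub>SR\<^esub> a) = \<ominus>\<^bsub>N\<^esub> f (x \<star>\<^bsub>M\<^esub> a)"
        by (simp add: N.ract_uminus_scalar closed)
      also have "\<dots> = f (\<ominus>\<^bsub>M\<^esub> (x \<star>\<^bsub>M\<^esub> a))"
        using uminus by (intro f_uminus[symmetric]) (simp add: M.ract_closed)
      finally show ?case
        using uminus by (simp add: M.ract_uminus_scalar)
    next
      case (mult a b)
      then show ?case by (simp add: M.ract_mult N.ract_mult M.ract_closed closed)
    qed
    with f closed f_add show "f \<in> rmodule_hom SR M N"
      by (auto simp: rmodule_hom_def pique_hom_def)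
  qed
qed

section \<open>The equivalence\<close>

context central
begin

interpretation MQ: SR_module module_of_pique
  by (simp add: SR_module_def module_of_pique(1))

text \<open>In each case the right side is the solution y of \<open>coef_action i y = x\<close>. For
  the third, \<open>r e (l x e) = x\<close> because \<open>m x (l x e) = e\<close>.\<close>

lemma inverse_coef_action:
  assumes x: "x \<in> A"
  shows "x \<star>\<^bsub>module_of_pique\<^esub> inv\<^bsub>SR\<^esub> X1 = m e x" "x \<star>\<^bsub>module_of_pique\<^esub> inv\<^bsub>SR\<^esub> X2 = r x e"
    "x \<star>\<^bsub>module_of_pique\<^esub> inv\<^bsub>SR\<^esub> X3 = l x e"
proof -
  have eqI: "x \<star>\<^bsub>module_of_pique\<^esub> inv\<^bsub>SR\<^esub> coef i = y" if "y \<in> A" "coef_action i y = x" for i y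
    using MQ.ract_inverse(1)[of y "coef i"] that by (simp add: module_of_pique)
  show "x \<star>\<^bsub>module_of_pique\<^esub> inv\<^bsub>SR\<^esub> X1 = m e x"
    using x ldiv_qmult[of e x] by (intro eqI) simp_all
  show "x \<star>\<^bsub>module_of_pique\<^esub> inv\<^bsub>SR\<^esub> X2 = r x e"
    using x qmult_rdiv[of e x] by (intro eqI) simp_all
  show "x \<star>\<^bsub>module_of_pique\<^esub> inv\<^bsub>SR\<^esub> X3 = l x e"
    using x rdiv_qmult[of "l x e" x] qmult_ldiv[of x e] by (intro eqI) simp_all
qed

text \<open>Agreement is claimed on the carrier only: as records the two piques may differ, so they
  are identified by an isomorphism and not by equality.\<close>

lemma pique_of_module_of_pique:
  assumes "x \<in> A" "y \<in> A"
  shows "qmult (pique_of_module module_of_pique) x y = m x y"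
    "rdiv (pique_of_module module_of_pique) x y = r x y"
    "ldiv (pique_of_module module_of_pique) x y = l x y"
  using assms linear[OF assms] by (simp_all add: module_of_pique inverse_coef_action)

end

lemma rmodule_hom_module_of_pique:
  assumes "central_pique P" "central_pique Q"
  shows "rmodule_hom SR (central.module_of_pique P) (central.module_of_pique Q) = pique_hom P Q"
proof -
  interpret P: central P by unfold_locales fact
  interpret Q: central Q by unfold_locales fact
  have "f \<in> pique_hom (pique_of_module P.module_of_pique) (pique_of_module Q.module_of_pique) \<longleftrightarrow>
      f \<in> pique_hom P Q" for f
  \<comment> \<open>The operations of the targets can be compared at \<open>f x\<close> only when
    \<open>f\<close> maps into the carrier of \<open>Q\<close>.\<close>
  proof (cases "f \<in> carrier P \<rightarrow>\<^sub>E carrier Q")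
    case True
    then have "f x \<in> carrier Q" if "x \<in> carrier P" for x
      using that by auto
    then show ?thesis
      unfolding pique_hom_def mem_Collect_eq
      by (intro conj_cong ball_cong)
        (simp_all add: P.pique_of_module_of_pique Q.pique_of_module_of_pique
          P.module_of_pique(2,3) Q.module_of_pique(2,3) del: pique_of_module_simps(3-5))
  next
    case False
    then show ?thesis
      by (simp add: pique_hom_def P.module_of_pique(2) Q.module_of_pique(2))
  qed
  then show ?thesis
    using rmodule_hom_eq_pique_hom[OF P.module_of_pique(1) Q.module_of_pique(1)] by blast
qed

section \<open>The two categories and the functors between them\<close>

lemma pique_hom_ident: "(\<lambda>x\<in>carrier P. x) \<in> pique_hom P P" if "pique P"
proof -
  interpret pique P by fact
  show ?thesis
    by (simp add: pique_hom_def qmult_closed rdiv_closed ldiv_closed point_closed)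
qed

lemma pique_hom_compose:
  assumes "pique P" and f: "f \<in> pique_hom P Q" and g: "g \<in> pique_hom Q R"
  shows "compose (carrier P) g f \<in> pique_hom P R"
proof -
  interpret pique P by fact
  have "f x \<in> carrier Q" if "x \<in> carrier P" for x
    using f that by (auto simp: pique_hom_def)
  moreover have "g x \<in> carrier R" if "x \<in> carrier Q" for x
    using g that by (auto simp: pique_hom_def)
  ultimately show ?thesis
    using f g by (simp add: pique_hom_def compose_def qmult_closed rdiv_closed ldiv_closed point_closed)
qed

lemma compose_ident:
  assumes "f \<in> extensional A" "f ` A \<subseteq> B"
  shows "compose A f (\<lambda>x\<in>A. x) = f" "compose A (\<lambda>x\<in>B. x) f = f"
  using assms by (auto simp: compose_def extensional_def fun_eq_iff)

lemma pique_hom_ident_compose: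
  assumes "f \<in> pique_hom P Q"
  shows "compose (carrier P) f (\<lambda>x\<in>carrier P. x) = f" "compose (carrier P) (\<lambda>x\<in>carrier Q. x) f = f"
  using assms by (intro compose_ident[where B = "carrier Q"]; auto simp: pique_hom_def PiE_def)+

lemma compose_compose:
  assumes "f ` A \<subseteq> B"
  shows "compose A h (compose A g f) = compose A (compose B h g) f"
  using assms by (auto simp: compose_def fun_eq_iff)

lemma pique_hom_assoc:
  assumes "f \<in> pique_hom P Q"
  shows "compose (carrier P) h (compose (carrier P) g f) = compose (carrier P) (compose (carrier Q) h g) f"
  using assms by (intro compose_compose) (auto simp: pique_hom_def)

lemma central_pique_cat_simps:
  "Obj central_pique_cat = {Q. central_pique Q}" "Hom central_pique_cat = pique_hom"
  "Ident central_pique_cat P = (\<lambda>x\<in>carrier P. x)"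
  "Comp central_pique_cat P Q R g f = compose (carrier P) g f"
  by (simp_all add: central_pique_cat_def)

lemma rmodule_cat_simps:
  "Obj (rmodule_cat R) = {M. right_module R M}" "Hom (rmodule_cat R) = rmodule_hom R"
  "Ident (rmodule_cat R) M = (\<lambda>x\<in>carrier M. x)"
  "Comp (rmodule_cat R) M N K g f = compose (carrier M) g f"
  by (simp_all add: rmodule_cat_def)

lemma central_pique_imp_pique: "central_pique P \<Longrightarrow> pique P"
  by (simp add: central_pique_def)

lemma cat_category_central_pique_cat: "cat_category central_pique_cat"
  by unfold_locales
    (simp_all add: central_pique_cat_simps central_pique_imp_pique pique_hom_ident
      pique_hom_compose pique_hom_ident_compose pique_hom_assoc)

lemma right_module_imp_pique:
  "right_module SR M \<Longrightarrow> pique (pique_of_module M)"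
  "right_module SR M \<Longrightarrow> central_pique (pique_of_module M)"
  by (simp_all add: SR_module.pique SR_module.central SR_module_def)

text \<open>Hom-sets, identities and composition are those of the associated piques, so the category
  laws are inherited from there.\<close>

lemma cat_category_rmodule_cat: "cat_category (rmodule_cat SR)"
proof -
  note simps = rmodule_cat_simps rmodule_hom_eq_pique_hom
  show ?thesis
  proof
    fix M N K :: "(selt, 'a) rmodule" and f g
    assume obj: "M \<in> Obj (rmodule_cat SR)" "N \<in> Obj (rmodule_cat SR)" "K \<in> Obj (rmodule_cat SR)"
      and hom: "f \<in> Hom (rmodule_cat SR) M N" "g \<in> Hom (rmodule_cat SR) N K"
    show "Comp (rmodule_cat SR) M N K g f \<in> Hom (rmodule_cat SR) M K"
      using obj hom pique_hom_compose[of "pique_of_module M" f "pique_of_module N" g "pique_of_module K"]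
      by (simp add: simps right_module_imp_pique)
    fix L :: "(selt, 'a) rmodule" and h
    show "Comp (rmodule_cat SR) M K L h (Comp (rmodule_cat SR) M N K g f) =
        Comp (rmodule_cat SR) M N L (Comp (rmodule_cat SR) N K L h g) f"
      using obj hom pique_hom_assoc[of f "pique_of_module M" "pique_of_module N" h g]
      by (simp add: simps)
  next
    fix M N :: "(selt, 'a) rmodule" and f
    assume obj: "M \<in> Obj (rmodule_cat SR)" "N \<in> Obj (rmodule_cat SR)"
      and hom: "f \<in> Hom (rmodule_cat SR) M N"
    show "Comp (rmodule_cat SR) M M N f (Ident (rmodule_cat SR) M) = f"
      "Comp (rmodule_cat SR) M N N (Ident (rmodule_cat SR) N) f = f"
      using obj hom pique_hom_ident_compose[of f "pique_of_module M" "pique_of_module N"]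
      by (simp_all add: simps)
  next
    fix M :: "(selt, 'a) rmodule"
    assume "M \<in> Obj (rmodule_cat SR)"
    then show "Ident (rmodule_cat SR) M \<in> Hom (rmodule_cat SR) M M"
      using pique_hom_ident[of "pique_of_module M"] by (simp add: simps right_module_imp_pique)
  qed
qed

lemma cat_functor_pique_of_module:
  "cat_functor (rmodule_cat SR) central_pique_cat pique_of_module (\<lambda>M N f. f)"
  using cat_category_rmodule_cat cat_category_central_pique_cat
  by (auto simp: cat_functor_def cat_functor_axioms_def rmodule_cat_simps central_pique_cat_simps
      right_module_imp_pique rmodule_hom_eq_pique_hom)

lemma central_module_of_pique:
  assumes "central_pique Q"
  shows "right_module SR (central.module_of_pique Q)" "carrier (central.module_of_pique Q) = carrier Q"
  using central.module_of_pique(1,2) assms by (auto simp: central_def)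

lemma cat_functor_module_of_pique:
  "cat_functor central_pique_cat (rmodule_cat SR) central.module_of_pique (\<lambda>P Q f. f)"
  using cat_category_rmodule_cat cat_category_central_pique_cat
  by (auto simp: cat_functor_def cat_functor_axioms_def rmodule_cat_simps central_pique_cat_simps
      central_module_of_pique rmodule_hom_module_of_pique)

lemma ident_hom_pique_of_module_of_pique:
  assumes "central_pique Q"
  defines "P \<equiv> pique_of_module (central.module_of_pique Q)"
  shows "(\<lambda>x\<in>carrier Q. x) \<in> pique_hom P Q" "(\<lambda>x\<in>carrier Q. x) \<in> pique_hom Q P"
proof -
  interpret central Q by unfold_locales fact
  show "(\<lambda>x\<in>carrier Q. x) \<in> pique_hom P Q" "(\<lambda>x\<in>carrier Q. x) \<in> pique_hom Q P"
    unfolding P_def pique_hom_def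
    by (simp_all add: pique_of_module_of_pique module_of_pique(2,3) del: pique_of_module_simps(3-5))
qed

text \<open>Both functors leave maps unchanged, and the natural isomorphisms are identity maps of
  carriers; naturality is the two identity laws.\<close>

lemma cat_equivalence_pique_of_module:
  "cat_equivalence (rmodule_cat SR :: ((selt, 'a) rmodule, 'a \<Rightarrow> 'a) cat) central_pique_cat
    pique_of_module (\<lambda>M N f. f)"
proof -
  have ident_compose: "compose A (\<lambda>x\<in>A. x) (\<lambda>x\<in>A. x) = (\<lambda>x\<in>A. x)" for A :: "'a set"
    by (simp add: compose_def fun_eq_iff)
  have iso_pique: "cat_iso central_pique_cat (pique_of_module (central.module_of_pique Q)) Q (\<lambda>x\<in>carrier Q. x)"
    if "central_pique Q" for Q :: "'a pique"
    unfolding cat_iso_def central_pique_cat_simps pique_of_module_simps(1) central_module_of_pique(2)[OF that]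
    using ident_hom_pique_of_module_of_pique[OF that] ident_compose by blast
  \<comment> \<open>Module homomorphisms are pique homomorphisms, so the isomorphism already found
    for the pique of \<open>M\<close> serves here as well.\<close>
  have iso_module: "cat_iso (rmodule_cat SR) M (central.module_of_pique (pique_of_module M)) (\<lambda>x\<in>carrier M. x)"
    if M: "right_module SR M" for M :: "(selt, 'a) rmodule"
  proof -
    note Q = right_module_imp_pique(2)[OF M]
    show ?thesis
      unfolding cat_iso_def rmodule_cat_simps central_module_of_pique(2)[OF Q] pique_of_module_simps(1)
        rmodule_hom_eq_pique_hom[OF M central_module_of_pique(1)[OF Q]]
        rmodule_hom_eq_pique_hom[OF central_module_of_pique(1)[OF Q] M]
      using ident_hom_pique_of_module_of_pique[OF Q] ident_compose
      unfolding pique_of_module_simps(1) by blast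
  qed
  have natural_module: "compose (carrier M) (\<lambda>x\<in>carrier N. x) f = compose (carrier M) f (\<lambda>x\<in>carrier M. x)"
    if "right_module SR M" "right_module SR N" "f \<in> rmodule_hom SR M N"
    for M N :: "(selt, 'a) rmodule" and f
    using that pique_hom_ident_compose[of f "pique_of_module M" "pique_of_module N"]
    by (simp add: rmodule_hom_eq_pique_hom)
  have natural_pique: "compose (carrier P) (\<lambda>x\<in>carrier Q. x) f = compose (carrier P) f (\<lambda>x\<in>carrier P. x)"
    if "f \<in> pique_hom P Q" for P Q :: "'a pique" and f
    using pique_hom_ident_compose[OF that] by simp
  show ?thesis
    unfolding cat_equivalence_def
  proof (intro conjI exI)
    show "cat_functor (rmodule_cat SR) central_pique_cat pique_of_module (\<lambda>M N f. f)"
      by (rule cat_functor_pique_of_module)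
    show "cat_functor central_pique_cat (rmodule_cat SR) central.module_of_pique (\<lambda>P Q f. f)"
      by (rule cat_functor_module_of_pique)
    show "cat_nat_iso (rmodule_cat SR :: ((selt, 'a) rmodule, 'a \<Rightarrow> 'a) cat) (rmodule_cat SR)
        (\<lambda>A. A) (\<lambda>A B f. f)
        (\<lambda>A. central.module_of_pique (pique_of_module A)) (\<lambda>A B f. f) (\<lambda>M. \<lambda>x\<in>carrier M. x)"
      using iso_module natural_module by (simp add: cat_nat_iso_def rmodule_cat_simps)
    show "cat_nat_iso (central_pique_cat :: ('a pique, 'a \<Rightarrow> 'a) cat) central_pique_cat
        (\<lambda>A. pique_of_module (central.module_of_pique A)) (\<lambda>A B f. f)
        (\<lambda>A. A) (\<lambda>A B f. f) (\<lambda>Q. \<lambda>x\<in>carrier Q. x)"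
      using iso_pique natural_pique
      by (simp add: cat_nat_iso_def central_pique_cat_simps central_module_of_pique)
  qed
qed

section \<open>Triality\<close>

text \<open>The values at 1 and 2 separate the six permutations, which lets the nested conditional
  in \<open>conj_op\<close> be resolved.\<close>

lemma S3_distinct:
  "distinct [id, sigma, tau, tau \<circ> sigma, sigma \<circ> tau, sigma \<circ> tau \<circ> sigma]"
proof -
  have "distinct (map (\<lambda>g. (g 1, g 2)) [id, sigma, tau, tau \<circ> sigma, sigma \<circ> tau, sigma \<circ> tau \<circ> sigma])"
    by simp
  then show ?thesis by (subst (asm) distinct_map) blast
qed

lemma conj_op_simps:
  "conj_op id Q x y = qmult Q x y" "conj_op sigma Q x y = qmult Q y x" "conj_op tau Q x y = ldiv Q x y"
  "conj_op (tau \<circ> sigma) Q x y = ldiv Q y x" "conj_op (sigma \<circ> tau) Q x y = rdiv Q y x"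
  "conj_op (sigma \<circ> tau \<circ> sigma) Q x y = rdiv Q x y"
  using S3_distinct by (auto simp: conj_op_def)

lemma triality_inv_X1: "g \<in> carrier S3 \<Longrightarrow> triality g (inv\<^bsub>SR\<^esub> X1) = inv\<^bsub>SR\<^esub> (triality_coef g V1)"
  using ring_hom_inv(2)[OF ring_SR ring_SR triality(1) coef_Units] by (simp add: triality(2))

text \<open>All six formulas are images of the single pair of coefficients of the multiplication;
  operations with exchanged arguments also use commutativity of addition.\<close>

lemma triality_represented_by:
  assumes g: "g \<in> carrier S3"
  shows "represented_by TYPE('a) g (triality g X2) (triality g (inv\<^bsub>SR\<^esub> X1))"
  unfolding represented_by_def
proof (intro allI impI ballI)
  fix M :: "(selt, 'a) rmodule" and x y
  assume "right_module SR M" and xy: "x \<in> carrier M" "y \<in> carrier M"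
  then interpret M: SR_module M by (simp add: SR_module_def)
  from S3_cases[OF g] have "conj_op g (pique_of_module M) x y =
      x \<star>\<^bsub>M\<^esub> triality_coef g V2 \<oplus>\<^bsub>M\<^esub> y \<star>\<^bsub>M\<^esub> inv\<^bsub>SR\<^esub> (triality_coef g V1)"
    using xy
    by (elim disjE; simp only: conj_op_simps pique_of_module_simps)
      (simp_all add: triality_coef_def Let_def gen_at_def M.ract_closed M.M.a_comm)
  then show "conj_op g (pique_of_module M) x y =
      x \<star>\<^bsub>M\<^esub> triality g X2 \<oplus>\<^bsub>M\<^esub> y \<star>\<^bsub>M\<^esub> triality g (inv\<^bsub>SR\<^esub> X1)"
    using g by (simp add: triality(2) triality_inv_X1)
qed

text \<open>In the regular module the arguments (1, 0) and (0, 1) return the two coefficients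
  themselves.\<close>

lemma represented_by_unique:
  assumes "represented_by TYPE(selt) g C D" "represented_by TYPE(selt) g C' D'"
    and closed: "C \<in> carrier SR" "D \<in> carrier SR" "C' \<in> carrier SR" "D' \<in> carrier SR"
  shows "C = C'" "D = D'"
proof -
  define M :: "(selt, selt) rmodule" where "M =
    \<lparr>carrier = carrier SR, monoid.mult = monoid.mult SR, one = \<one>\<^bsub>SR\<^esub>, ring.zero = \<zero>\<^bsub>SR\<^esub>,
     add = add SR, ract = monoid.mult SR\<rparr>"
  have "abelian_group M"
    by (rule abelian_groupI) (auto simp: M_def SR.a_ac intro: SR.l_neg)
  then have M: "right_module SR M"
    using ring_SR
    by (auto simp: right_module_def right_module_axioms_def M_def SR.l_distr SR.r_distr SR.m_assoc)
  have "x \<otimes>\<^bsub>SR\<^esub> C \<oplus>\<^bsub>SR\<^esub> y \<otimes>\<^bsub>SR\<^esub> D = x \<otimes>\<^bsub>SR\<^esub> C' \<oplus>\<^bsub>SR\<^esub> y \<otimes>\<^bsub>SR\<^esub> D'"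
    if "x \<in> carrier SR" "y \<in> carrier SR" for x y
    using assms(1,2) M that by (force simp: represented_by_def M_def)
  from this[of "\<one>\<^bsub>SR\<^esub>" "\<zero>\<^bsub>SR\<^esub>"] this[of "\<zero>\<^bsub>SR\<^esub>" "\<one>\<^bsub>SR\<^esub>"] closed
  show "C = C'" "D = D'" by simp_all
qed

text \<open>By uniqueness \<open>C\<close> and \<open>D\<close> are the images under
  \<open>h\<close> of the coefficients of the multiplication; applying \<open>g\<close> gives the
  images under the product.\<close>

lemma triality_action:
  assumes g: "g \<in> carrier S3" and h: "h \<in> carrier S3" and CD: "C \<in> carrier SR" "D \<in> carrier SR"
    and rep: "represented_by TYPE(selt) h C D"
  shows "represented_by TYPE('a) (h \<otimes>\<^bsub>S3\<^esub> g) (triality g C) (triality g D)"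
proof -
  have closed: "triality h a \<in> carrier SR" if "a \<in> carrier SR" for a
    using ring_hom_closed[OF triality(1)[OF h] that] .
  have "C = triality h X2" "D = triality h (inv\<^bsub>SR\<^esub> X1)"
    using represented_by_unique[OF rep triality_represented_by[OF h]] CD closed by simp_all
  then have "triality g C = triality (h \<otimes>\<^bsub>S3\<^esub> g) X2" "triality g D = triality (h \<otimes>\<^bsub>S3\<^esub> g) (inv\<^bsub>SR\<^esub> X1)"
    by (simp_all only: triality_mult[OF h g] compose_eq coef_closed coef_inv_closed)
  then show ?thesis
    using triality_represented_by[OF S3.m_closed[OF h g]] by simp
qed

theorem theorem7p4:
  shows
    "X1 \<in> Units SR \<and> X2 \<in> Units SR \<and> X3 \<in> Units SR \<and>
     (\<exists>!\<alpha>. generated_S3_action \<alpha>) \<and>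
     (\<forall>M :: (selt, 'a) rmodule. right_module SR M \<longrightarrow> central_pique (pique_of_module M)) \<and>
     cat_equivalence
       (rmodule_cat SR :: ((selt, 'a) rmodule, 'a \<Rightarrow> 'a) cat)
       (central_pique_cat :: ('a pique, 'a \<Rightarrow> 'a) cat)
       pique_of_module (\<lambda>M N f. f) \<and>
     (\<forall>\<alpha>. generated_S3_action \<alpha> \<longrightarrow>
       (\<forall>g\<in>carrier S3. \<forall>h\<in>carrier S3. \<forall>C\<in>carrier SR. \<forall>D\<in>carrier SR.
         represented_by TYPE(selt) h C D \<longrightarrow>
         represented_by TYPE('a) (h \<otimes>\<^bsub>S3\<^esub> g) (\<alpha> g C) (\<alpha> g D)))"
proof (intro conjI allI impI ballI)
  show "\<exists>!\<alpha>. generated_S3_action \<alpha>"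
    using generated_S3_action_triality generated_S3_action_unique by blast
next
  fix \<alpha> g h C D
  assume "generated_S3_action \<alpha>" and "g \<in> carrier S3" "h \<in> carrier S3" "C \<in> carrier SR" "D \<in> carrier SR"
    "represented_by TYPE(selt) h C D"
  then show "represented_by TYPE('a) (h \<otimes>\<^bsub>S3\<^esub> g) (\<alpha> g C) (\<alpha> g D)"
    using triality_action generated_S3_action_unique by fastforce
qed (simp_all only: coef_Units right_module_imp_pique cat_equivalence_pique_of_module)

end
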